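(* Let $k,l\geq 2$ be integers. Then \[ \mathrm{ex}(n,P_l,\textnormal{rainbow-}C_{2k})= \begin{cases} \Theta(n^{\lceil (l+1)/2\rceil}) & \text{if } k\geq 3,\\ \Theta(n^{l/2+1}) & \text{if } k=2. \end{cases} \]
   Context: A proper edge-colouring of a graph assigns colours to edges so that any two edges sharing a vertex receive different colours. A subgraph of an edge-coloured graph is rainbow if all its edges have distinct colours. For graphs $H,F$, $\mathrm{ex}(n,H,\textnormal{rainbow-}F)$ denotes the maximum number of copies of $H$ (subgraphs isomorphic to $H$) in a properly edge-coloured graph on $n$ vertices that contains no rainbow subgraph isomorphic to $F$. $P_l$ denotes the path with $l$ edges and $l+1$ vertices, and $C_m$ the cycle of length $m$. The constants implied by $\Theta$ may depend on $k$ and $l$. *)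

theory Defs
  imports Complex_Main "HOL-Library.Landau_Symbols"
begin

type_synonym 'a graph = "'a set \<times> 'a set set"

abbreviation verts :: "'a graph \<Rightarrow> 'a set" where
  "verts G \<equiv> fst G"

abbreviation edges :: "'a graph \<Rightarrow> 'a set set" where
  "edges G \<equiv> snd G"

definition simple_graph :: "'a graph \<Rightarrow> bool" where
  "simple_graph G \<longleftrightarrow> finite (verts G) \<and> (\<forall>e\<in>edges G. e \<subseteq> verts G \<and> card e = 2)"

definition subgraph :: "'a graph \<Rightarrow> 'a graph \<Rightarrow> bool" where
  "subgraph S G \<longleftrightarrow> simple_graph S \<and> verts S \<subseteq> verts G \<and> edges S \<subseteq> edges G"

definition graph_iso :: "'a graph \<Rightarrow> 'b graph \<Rightarrow> bool" where
  "graph_iso G H \<longleftrightarrow> (\<exists>f. bij_betw f (verts G) (verts H) \<and>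
     (\<forall>u\<in>verts G. \<forall>v\<in>verts G. {u, v} \<in> edges G \<longleftrightarrow> {f u, f v} \<in> edges H))"

text \<open>Copies are unlabelled: a copy is a subgraph, not an embedding.\<close>

definition copies :: "'b graph \<Rightarrow> 'a graph \<Rightarrow> 'a graph set" where
  "copies H G = {S. subgraph S G \<and> graph_iso S H}"

definition proper_edge_colouring :: "'a graph \<Rightarrow> ('a set \<Rightarrow> 'c) \<Rightarrow> bool" where
  "proper_edge_colouring G c \<longleftrightarrow>
     (\<forall>e\<in>edges G. \<forall>e'\<in>edges G. e \<noteq> e' \<and> e \<inter> e' \<noteq> {} \<longrightarrow> c e \<noteq> c e')"

definition rainbow :: "('a set \<Rightarrow> 'c) \<Rightarrow> 'a graph \<Rightarrow> bool" where
  "rainbow c S \<longleftrightarrow> inj_on c (edges S)"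

text \<open>Vertices and colours are natural numbers, which loses nothing since all graphs are finite.
  The set under \<open>Max\<close> is finite, and it is nonempty as soon as \<open>F\<close> has an edge (consider the
  edgeless graph on \<open>n\<close> vertices).\<close>

definition ex_rainbow :: "nat \<Rightarrow> 'a graph \<Rightarrow> 'b graph \<Rightarrow> nat" where
  "ex_rainbow n H F = Max {card (copies H G) | (G :: nat graph) (c :: nat set \<Rightarrow> nat).
     simple_graph G \<and> card (verts G) = n \<and> proper_edge_colouring G c \<and>
     \<not> (\<exists>S \<in> copies F G. rainbow c S)}"

definition path_graph :: "nat \<Rightarrow> nat graph" where
  "path_graph l = ({0..l}, {{i, Suc i} | i. i < l})"

text \<open>This is the cycle of length \<open>m\<close> only for \<open>m \<ge> 3\<close>.\<close>

definition cycle_graph :: "nat \<Rightarrow> nat graph" where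
  "cycle_graph m = ({0..<m}, {{i, Suc i mod m} | i. i < m})"

end

(* Upper bound. Two vertices with many common neighbours ("heavy" pairs) can be joined greedily by a
  path of length two that avoids any bounded set of vertices and colours. Since a graph of large
  average degree contains a subgraph of large minimum degree, greedy rainbow paths show that, for
  fixed k, every set A of neighbours of a vertex sends O(|A| + |Y|) edges to any set Y. Hence only O(n)
  walks of length two leave a vertex, only O(n^2) walks of length three contain a heavy pair at
  distance two, and a set A of neighbours contains O(|A|) heavy pairs. Consider the remaining walks
  x a b y of length three. Two of them with the same ends and the same middle colour close up to a
  hexagon, and rotating the hexagon shows that the number of such pairs is linear in the number of
  walks. So most of the walks x a b y share their ends and the colour of a b with boundedly many
  others, and if more than O(n) of them started at a vertex x, a greedy rainbow path on the edges b y
  could be closed to a rainbow cycle through x. This bounds the number of walks of length three by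
  O(n^2) when k >= 3; longer walks are extended two steps at a time.

  Lower bound. For k >= 3 blow up the even vertices of the path; all cycles of the resulting graph
  have length four. For k = 2 use the incidence graph of an affine plane of order 2^j, which has no
  cycle of length four; a power of two is available within a factor of two of every size, so the
  distribution of primes plays no role. *)

theory Submission
  imports Defs "HOL-Analysis.Convex" "HOL-Library.Z2" "HOL-Algebra.Algebraic_Closure_Type"
begin

section \<open>Counting and minimum degree\<close>

text \<open>Double counting: compare the fibres over each value of \<open>f\<close> and sum. The two
  factors allow fibres to be bounded from below or from above without division.\<close>

lemma card_mult_le_fibrewise:
  assumes "finite S" "finite T"
    and "\<And>a. a \<in> f ` S \<Longrightarrow> c * card {s\<in>S. f s = a} \<le> d * card {t\<in>T. g t = a}"
  shows "c * card S \<le> d * card T"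
proof -
  have "card S = (\<Sum>a\<in>f ` S. card {s\<in>S. f s = a})"
    using assms(1) by (subst card_UN_disjoint[symmetric]) (auto intro!: arg_cong[where f = card])
  hence "c * card S = (\<Sum>a\<in>f ` S. c * card {s\<in>S. f s = a})"
    by (simp add: sum_distrib_left)
  also have "\<dots> \<le> (\<Sum>a\<in>f ` S. d * card {t\<in>T. g t = a})"
    by (intro sum_mono assms(3))
  also have "\<dots> = d * card (\<Union>a\<in>f ` S. {t\<in>T. g t = a})"
    using assms(1,2) by (subst card_UN_disjoint) (auto simp: sum_distrib_left)
  also have "\<dots> \<le> d * card T"
    using assms(2) by (intro mult_left_mono card_mono) auto
  finally show ?thesis .
qed

lemma card_le_fibres:
  assumes "finite S" "finite B" "f ` S \<subseteq> B"
    and "\<And>b. b \<in> B \<Longrightarrow> card {s\<in>S. f s = b} \<le> d"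
  shows "card S \<le> d * card B"
proof -
  have "1 * card S \<le> d * card B"
  proof (rule card_mult_le_fibrewise[where f = f and g = id])
    fix a assume a: "a \<in> f ` S"
    hence "{t\<in>B. id t = a} = {a}" using assms(3) by auto
    thus "1 * card {s\<in>S. f s = a} \<le> d * card {t\<in>B. id t = a}"
      using assms(3,4) a by auto
  qed (use assms in auto)
  thus ?thesis by simp
qed

text \<open>Deleting a vertex of degree at most \<open>D\<close> removes at most \<open>D\<close>
  pairs and lowers \<open>card A + card B\<close> by one, so the density hypothesis survives and
  keeps the relation nonempty. The sides are counted separately and may overlap.\<close>

lemma bipartite_min_degree:
  assumes "finite A" "finite B" "R \<subseteq> A \<times> B" "D * (card A + card B) < card R"
  shows "\<exists>R'\<subseteq>R. R' \<noteq> {} \<and> (\<forall>(a, b)\<in>R'. D < card (R' `` {a}) \<and> D < card (R'\<inverse> `` {b}))"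
  using assms
proof (induction "card A + card B" arbitrary: A B R rule: less_induct)
  case less
  have finR: "finite R"
    using less.prems(1-3) by (metis finite_SigmaI finite_subset)
  show ?case
  proof (cases "\<forall>(a, b)\<in>R. D < card (R `` {a}) \<and> D < card (R\<inverse> `` {b})")
    case True
    thus ?thesis using less.prems(4) by (intro exI[of _ R]) auto
  next
    case False
    then obtain a b where ab: "(a, b) \<in> R" "card (R `` {a}) \<le> D \<or> card (R\<inverse> `` {b}) \<le> D"
      by force
    hence mem: "a \<in> A" "b \<in> B" using less.prems(3) by auto
    hence pos: "card A > 0" "card B > 0" using less.prems(1,2) by (auto simp: card_gt_0_iff)
    from ab(2) show ?thesis
    proof
      assume d: "card (R `` {a}) \<le> D"
      let ?R = "R - {a} \<times> R `` {a}"
      have "card R \<le> card ?R + card ({a} \<times> R `` {a})"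
        using diff_card_le_card_Diff[of "{a} \<times> R `` {a}" R] finR by simp
      hence "D * (card (A - {a}) + card B) < card ?R"
        using d less.prems(1,4) mem pos
        by (auto simp: card_cartesian_product algebra_simps diff_mult_distrib2)
          (use \<open>card A > 0\<close> in \<open>cases "card A"; simp\<close>)
      moreover have "?R \<subseteq> (A - {a}) \<times> B" using less.prems(3) by auto
      moreover have "card (A - {a}) + card B < card A + card B"
        using mem less.prems(1) pos by simp
      ultimately show ?thesis
        using less.hyps[of "A - {a}" B ?R] less.prems(1,2) by (meson Diff_subset finite_Diff subset_trans)
    next
      assume d: "card (R\<inverse> `` {b}) \<le> D"
      let ?R = "R - R\<inverse> `` {b} \<times> {b}"
      have "card R \<le> card ?R + card (R\<inverse> `` {b} \<times> {b})"
        using diff_card_le_card_Diff[of "R\<inverse> `` {b} \<times> {b}" R] finR by simp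
      hence "D * (card A + card (B - {b})) < card ?R"
        using d less.prems(2,4) mem pos
        by (auto simp: card_cartesian_product algebra_simps diff_mult_distrib2)
          (use \<open>card B > 0\<close> in \<open>cases "card B"; simp\<close>)
      moreover have "?R \<subseteq> A \<times> (B - {b})" using less.prems(3) by auto
      moreover have "card A + card (B - {b}) < card A + card B"
        using mem less.prems(2) pos by simp
      ultimately show ?thesis
        using less.hyps[of A "B - {b}" ?R] less.prems(1,2) by (meson Diff_subset finite_Diff subset_trans)
    qed
  qed
qed

text \<open>The same deletion on one vertex set: a vertex takes up to \<open>2 * D\<close> ordered
  pairs with it, whence the factor 2.\<close>

lemma symmetric_min_degree:
  assumes "finite U" "sym R" "2 * D * card U < card (R \<inter> U \<times> U)"
  shows "\<exists>W\<subseteq>U. W \<noteq> {} \<and> (\<forall>u\<in>W. D < card {w\<in>W. (u, w) \<in> R})"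
  using assms
proof (induction "card U" arbitrary: U rule: less_induct)
  case less
  show ?case
  proof (cases "\<forall>u\<in>U. D < card {w\<in>U. (u, w) \<in> R}")
    case True
    thus ?thesis using less.prems(3) by (intro exI[of _ U]) auto
  next
    case False
    then obtain u where u: "u \<in> U" "card {w\<in>U. (u, w) \<in> R} \<le> D" by force
    let ?N = "{w\<in>U. (u, w) \<in> R}"
    have pos: "card U > 0" using u less.prems(1) by (auto simp: card_gt_0_iff)
    have fN: "finite ?N" using less.prems(1) by auto
    have "R \<inter> U \<times> U \<subseteq> (R \<inter> (U - {u}) \<times> (U - {u})) \<union> ({u} \<times> ?N \<union> ?N \<times> {u})"
      using \<open>sym R\<close> by (auto dest: symD)
    hence "card (R \<inter> U \<times> U) \<le> card (R \<inter> (U - {u}) \<times> (U - {u})) + card ({u} \<times> ?N \<union> ?N \<times> {u})"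
      using less.prems(1) fN
      by (intro order_trans[OF card_mono card_Un_le]) auto
    also have "card ({u} \<times> ?N \<union> ?N \<times> {u}) \<le> 2 * D"
      by (rule order_trans[OF card_Un_le]) (use u(2) in \<open>simp add: card_cartesian_product\<close>)
    finally have "2 * D * card (U - {u}) < card (R \<inter> (U - {u}) \<times> (U - {u}))"
      using less.prems(1,3) u(1) pos
      by (cases "card U") (auto simp: algebra_simps)
    moreover have "card (U - {u}) < card U" using u less.prems(1) pos by simp
    ultimately show ?thesis
      using less.hyps[of "U - {u}"] less.prems(1,2) by (meson Diff_subset finite_Diff subset_trans)
  qed
qed

section \<open>Greedy rainbow cycles\<close>

fun path_cols :: "('a \<Rightarrow> 'a \<Rightarrow> 'c) \<Rightarrow> 'a list \<Rightarrow> 'c list" where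
  "path_cols col (u # v # p) = col u v # path_cols col (v # p)"
| "path_cols col _ = []"

lemma path_cols_Cons: "p \<noteq> [] \<Longrightarrow> path_cols col (u # p) = col u (hd p) # path_cols col p"
  by (cases p) auto

lemma length_path_cols: "length (path_cols col p) = length p - 1"
  by (induction col p rule: path_cols.induct) auto

definition rainbow_path :: "('a \<Rightarrow> 'a \<Rightarrow> bool) \<Rightarrow> ('a \<Rightarrow> 'a \<Rightarrow> 'c) \<Rightarrow> 'a list \<Rightarrow> bool" where
  "rainbow_path adj col p \<longleftrightarrow>
     p \<noteq> [] \<and> successively adj p \<and> distinct p \<and> distinct (path_cols col p)"

lemma rainbow_path_Cons:
  "p \<noteq> [] \<Longrightarrow> rainbow_path adj col (u # p) \<longleftrightarrow>
     adj u (hd p) \<and> u \<notin> set p \<and> col u (hd p) \<notin> set (path_cols col p) \<and> rainbow_path adj col p"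
  by (auto simp: rainbow_path_def successively_Cons path_cols_Cons)

lemma rainbow_path_suffix: "rainbow_path adj col (t @ p) \<Longrightarrow> p \<noteq> [] \<Longrightarrow> rainbow_path adj col p"
  by (induction t) (auto simp: rainbow_path_Cons)

lemma card_path_le: "card (set p) \<le> length p" "card (set (path_cols col p)) \<le> length p - 1"
  using card_length[of p] card_length[of "path_cols col p"] by (simp_all add: length_path_cols)

text \<open>A cycle is stored as a list of \<open>2 * k\<close> vertices with a closing edge between
  \<open>hd\<close> and \<open>last\<close>, which suits paths grown at the head while the last
  vertex stays fixed.\<close>

locale rainbow_cycle_free =
  fixes V :: "'a set" and adj :: "'a \<Rightarrow> 'a \<Rightarrow> bool" and col :: "'a \<Rightarrow> 'a \<Rightarrow> 'c" and k :: nat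
  assumes finite_V: "finite V"
    and adj_V: "adj u v \<Longrightarrow> u \<in> V"
    and adj_sym: "adj u v \<Longrightarrow> adj v u"
    and adj_irrefl: "\<not> adj u u"
    and col_sym: "col u v = col v u"
    and col_proper: "adj u v \<Longrightarrow> adj u w \<Longrightarrow> col u v = col u w \<Longrightarrow> v = w"
    and k_ge_2: "2 \<le> k"
    and no_rainbow_cycle: "rainbow_path adj col p \<Longrightarrow> length p = 2 * k \<Longrightarrow> adj (hd p) (last p) \<Longrightarrow>
          col (hd p) (last p) \<in> set (path_cols col p)"
begin

abbreviation "rpath \<equiv> rainbow_path adj col"
abbreviation "cols \<equiv> path_cols col"

definition N :: "'a \<Rightarrow> 'a set" where "N v = {u. adj v u}"

lemma in_N [simp]: "u \<in> N v \<longleftrightarrow> adj v u"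
  by (simp add: N_def)

lemma adj_V2: "adj u v \<Longrightarrow> v \<in> V"
  using adj_sym adj_V by blast

lemma N_subset: "N v \<subseteq> V"
  by (auto dest: adj_V2)

lemma finite_N [simp]: "finite (N v)"
  using N_subset finite_V finite_subset by blast

lemma card_N_le: "card (N v) \<le> card V"
  using N_subset finite_V by (rule card_mono[rotated])

lemma adj_commute: "adj u v \<longleftrightarrow> adj v u"
  using adj_sym by blast

lemma card_forbidden_colours:
  assumes "S \<subseteq> N v" "finite C"
  shows "card {u\<in>S. col v u \<in> C} \<le> card C"
proof (rule card_inj_on_le[where f = "col v"])
  show "inj_on (col v) {u\<in>S. col v u \<in> C}"
  proof (rule inj_onI)
    fix a b assume "a \<in> {u\<in>S. col v u \<in> C}" "b \<in> {u\<in>S. col v u \<in> C}" "col v a = col v b"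
    thus "a = b" using assms(1) by (intro col_proper[of v a b]) auto
  qed
qed (use assms in auto)

text \<open>The union bound behind every greedy choice: \<open>F\<close> holds vertices to avoid,
  \<open>C\<close> colours, and \<open>P\<close> marks up to \<open>e\<close> further bad
  candidates. By properness each colour excludes at most one neighbour.\<close>

lemma avoid:
  assumes "S \<subseteq> N v" "finite F" "finite C" "card {u\<in>S. P u} \<le> e" "card F + card C + e < card S"
  shows "\<exists>u\<in>S. u \<notin> F \<and> col v u \<notin> C \<and> \<not> P u"
proof (rule ccontr)
  assume "\<not> ?thesis"
  hence "S \<subseteq> F \<union> ({u\<in>S. col v u \<in> C} \<union> {u\<in>S. P u})" by auto
  hence "card S \<le> card (F \<union> ({u\<in>S. col v u \<in> C} \<union> {u\<in>S. P u}))"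
    using assms finite_subset[OF assms(1) finite_N] by (intro card_mono) auto
  also have "\<dots> \<le> card F + (card {u\<in>S. col v u \<in> C} + card {u\<in>S. P u})"
    by (intro order_trans[OF card_Un_le] add_left_mono card_Un_le)
  also have "\<dots> \<le> card F + (card C + e)"
    using assms by (intro add_mono card_forbidden_colours) auto
  finally show False using assms by simp
qed

text \<open>The path grows at its head by \<open>z\<close> and \<open>b\<close> in each of
  \<open>m + 1\<close> rounds, always ending in \<open>x\<close>. In the last round the
  \<open>s\<close> vertices of \<open>t\<close> are kept too, and the edge from the new head to
  \<open>x\<close> closes a rainbow cycle.\<close>

lemma greedy_cycle:
  assumes "rpath p" "hd p \<in> B" "last p = x" "length p + 2 * Suc m + s = 2 * k"
    and extend: "\<And>q. rpath q \<Longrightarrow> hd q \<in> B \<Longrightarrow> last q = x \<Longrightarrow> length q < 2 * k \<Longrightarrow>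
      \<exists>z b t. b \<in> B \<and> length t = s \<and> rpath (t @ b # z # q) \<and> adj (hd (t @ [b])) x \<and>
        col (hd (t @ [b])) x \<notin> set (cols (t @ b # z # q))"
  shows False
  using assms(1-4)
proof (induction m arbitrary: p)
  case 0
  then obtain z b t where *: "length t = s" "rpath (t @ b # z # p)" "adj (hd (t @ [b])) x"
      "col (hd (t @ [b])) x \<notin> set (cols (t @ b # z # p))"
    using extend[of p] by auto
  have "p \<noteq> []" using 0(1) by (simp add: rainbow_path_def)
  hence "last (t @ b # z # p) = x" "hd (t @ b # z # p) = hd (t @ [b])"
    using 0(3) by (auto simp: hd_append)
  with no_rainbow_cycle[OF *(2)] * 0(4) show False by auto
next
  case (Suc m)
  then obtain z b t where *: "b \<in> B" "length t = s" "rpath (t @ b # z # p)"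
    using extend[of p] by auto
  have "p \<noteq> []" using Suc.prems(1) by (simp add: rainbow_path_def)
  \<comment> \<open>Before the last round \<open>t\<close> is discarded, which restores a head in
    \<open>B\<close>.\<close>
  moreover have "rpath (b # z # p)" using *(3) by (rule rainbow_path_suffix) simp
  ultimately show False
    using * Suc.prems by (intro Suc.IH[of "b # z # p"]) auto
qed

lemma rpath_edge: "adj u v \<Longrightarrow> rpath [u, v]"
  using adj_irrefl by (auto simp: rainbow_path_def)

text \<open>Otherwise some nonempty subrelation has all degrees above \<open>6 * k\<close>. A greedy
  path from \<open>v\<close> alternates between \<open>A\<close> and \<open>Y\<close>; all of
  \<open>A\<close> is adjacent to \<open>v\<close>, so it closes up once it has \<open>2 * k\<close>
  vertices.\<close>

lemma edges_from_neighbourhood: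
  assumes A: "A \<subseteq> N v" and "finite Y"
  shows "card {(b, y). b \<in> A \<and> y \<in> Y \<and> adj b y} \<le> 6 * k * (card A + card Y)"
proof (rule ccontr)
  let ?R = "{(b, y). b \<in> A \<and> y \<in> Y \<and> adj b y}"
  assume "\<not> ?thesis"
  moreover have "finite A" using A finite_N finite_subset by blast
  moreover have "?R \<subseteq> A \<times> Y" by auto
  ultimately have "\<exists>R\<subseteq>?R. R \<noteq> {} \<and> (\<forall>(b, y)\<in>R. 6 * k < card (R `` {b}) \<and> 6 * k < card (R\<inverse> `` {y}))"
    using \<open>finite Y\<close> by (intro bipartite_min_degree[of A Y]) (auto simp: not_le)
  then obtain R where R: "R \<subseteq> ?R" "R \<noteq> {}"
    and deg': "\<forall>(b, y)\<in>R. 6 * k < card (R `` {b}) \<and> 6 * k < card (R\<inverse> `` {y})"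
    by blast
  have deg: "6 * k < card (R `` {b})" "6 * k < card (R\<inverse> `` {y})" if "(b, y) \<in> R" for b y
    using deg' that by auto
  obtain b\<^sub>0 y\<^sub>0 where "(b\<^sub>0, y\<^sub>0) \<in> R" using R(2) by auto
  show False
  proof (rule greedy_cycle[where p = "[b\<^sub>0, v]" and B = "Domain R" and x = v and s = 0 and m = "k - 2"])
    show "rpath [b\<^sub>0, v]"
      using \<open>(b\<^sub>0, y\<^sub>0) \<in> R\<close> R(1) A by (intro rpath_edge, subst adj_commute) auto
    show "hd [b\<^sub>0, v] \<in> Domain R" using \<open>(b\<^sub>0, y\<^sub>0) \<in> R\<close> by auto
    show "length [b\<^sub>0, v] + 2 * Suc (k - 2) + 0 = 2 * k" using k_ge_2 by simp
    fix q assume q: "rpath q" "hd q \<in> Domain R" "last q = v" "length q < 2 * k"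
    let ?b = "hd q"
    have q0: "q \<noteq> []" using q(1) by (simp add: rainbow_path_def)
    have vq: "v \<in> set q" using q0 q(3) by auto
    have cq: "card (set q) \<le> 2 * k" "card (set (cols q)) \<le> 2 * k"
      using card_path_le(1)[of q] card_path_le(2)[of col q] q(4) by linarith+
    have "R `` {?b} \<subseteq> N ?b" using R(1) by auto
    moreover have "6 * k < card (R `` {?b})" using q(2) deg by auto
    ultimately obtain y where y: "(?b, y) \<in> R" "y \<notin> set q" "col ?b y \<notin> set (cols q)"
      using avoid[of "R `` {?b}" ?b "set q" "set (cols q)" "\<lambda>_. False" 0] cq by auto
    have "adj ?b y" using y(1) R(1) by auto
    hence ay: "adj y ?b" by (rule adj_sym)
    have p1: "rpath (y # q)"
      using q0 y q(1) ay by (simp add: rainbow_path_Cons col_sym)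
    have S: "R\<inverse> `` {y} \<subseteq> N y"
    proof
      fix b assume "b \<in> R\<inverse> `` {y}"
      hence "adj b y" using R(1) by auto
      thus "b \<in> N y" by (simp add: adj_commute[of y])
    qed
    have Sv: "R\<inverse> `` {y} \<subseteq> N v" using R(1) A by auto
    have c1: "card (set (cols (y # q))) \<le> 2 * k"
      using card_path_le(2)[of col "y # q"] q(4) by simp
    \<comment> \<open>The choice of \<open>b\<close> avoids up to \<open>2 * k\<close> vertices,
      \<open>2 * k\<close> colours on \<open>y b\<close> and \<open>2 * k\<close> colours on the
      closing edge \<open>b v\<close>: hence \<open>6 * k\<close>.\<close>
    have "card {b \<in> R\<inverse> `` {y}. col v b \<in> set (cols (y # q))} \<le> 2 * k"
      using card_forbidden_colours[OF Sv, of "set (cols (y # q))"] c1 by simp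
    moreover have "6 * k < card (R\<inverse> `` {y})" using y(1) deg by auto
    ultimately obtain b where b: "(b, y) \<in> R" "b \<notin> set q" "col y b \<notin> set (cols (y # q))"
        "col v b \<notin> set (cols (y # q))"
      using avoid[OF S, of "set q" "set (cols (y # q))" "\<lambda>b. col v b \<in> set (cols (y # q))" "2 * k"] cq c1
      by auto
    have ab: "adj b y" "adj v b" using b(1) R(1) A by auto
    have "b \<noteq> y" using ab(1) adj_irrefl by auto
    hence p2: "rpath (b # y # q)"
      using b p1 ab by (simp add: rainbow_path_Cons[of "y # q"] col_sym[of b y])
    have bv: "adj b v" using ab(2) by (rule adj_sym)
    hence "col b v \<noteq> col b y"
      using col_proper[of b v y] ab(1) y(2) vq by auto
    hence "col b v \<notin> set (cols (b # y # q))"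
      using b(4) col_sym[of b v] by simp
    thus "\<exists>z b t. b \<in> Domain R \<and> length t = 0 \<and> rpath (t @ b # z # q) \<and>
        adj (hd (t @ [b])) v \<and> col (hd (t @ [b])) v \<notin> set (cols (t @ b # z # q))"
      using b(1) bv p2 by (intro exI[of _ y] exI[of _ b]) auto
  qed auto
qed

text \<open>A common neighbourhood of this size permits a greedy choice that avoids all vertices and colours
  of a cycle of length \<open>2 k\<close>.\<close>

definition heavy :: "'a \<Rightarrow> 'a \<Rightarrow> bool" where
  "heavy u v \<longleftrightarrow> 12 * k \<le> card (N u \<inter> N v)"

lemma heavy_commute: "heavy u v \<longleftrightarrow> heavy v u"
  by (simp add: heavy_def Int_commute)

text \<open>Each heavy partner of \<open>a\<close> receives at least \<open>12 * k\<close> edges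
  from \<open>N a\<close>, twice what \<open>edges_from_neighbourhood\<close> charges to a vertex of
  \<open>?Y\<close>, so the term in \<open>card ?Y\<close> is absorbed.\<close>

lemma edges_to_heavy:
  "card {(b, y). adj a b \<and> adj b y \<and> heavy a y} \<le> 12 * k * card (N a)"
proof -
  let ?Y = "{y\<in>V. heavy a y}"
  let ?E = "{(b, y). b \<in> N a \<and> y \<in> ?Y \<and> adj b y}"
  have fin: "finite ?E"
    by (rule finite_subset[of _ "V \<times> V"]) (auto simp: finite_V dest: adj_V)
  have "12 * k * card ?Y \<le> 1 * card ?E"
  proof (rule card_mult_le_fibrewise[where f = id and g = snd])
    fix y assume "y \<in> id ` ?Y"
    hence y: "y \<in> V" "heavy a y" by auto
    have "{s \<in> ?Y. id s = y} = {y}" using y by auto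
    moreover have "{t \<in> ?E. snd t = y} = (\<lambda>b. (b, y)) ` (N a \<inter> N y)"
      using y by (auto simp: adj_commute[of y])
    ultimately show "12 * k * card {s \<in> ?Y. id s = y} \<le> 1 * card {t \<in> ?E. snd t = y}"
      using y(2) by (simp add: card_image inj_on_def heavy_def)
  qed (use finite_V fin in auto)
  moreover have "card ?E \<le> 6 * k * (card (N a) + card ?Y)"
    by (rule edges_from_neighbourhood) (auto simp: finite_V)
  moreover have "?E = {(b, y). adj a b \<and> adj b y \<and> heavy a y}"
    by (auto dest: adj_V2)
  ultimately show ?thesis by (simp add: algebra_simps)
qed

text \<open>Otherwise a subset \<open>W\<close> of \<open>A\<close> has all heavy degrees above
  \<open>6 * k\<close>. A greedy path moves along heavy pairs of \<open>W\<close>, joins each pair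
  through a common neighbour, and closes through \<open>x\<close>.\<close>

lemma heavy_pairs_in_neighbourhood:
  assumes A: "A \<subseteq> N x"
  shows "card {(a, a'). a \<in> A \<and> a' \<in> A \<and> a \<noteq> a' \<and> heavy a a'} \<le> 12 * k * card A"
proof (rule ccontr)
  let ?R = "{(a, a'). a \<noteq> a' \<and> heavy a a'}"
  assume *: "\<not> ?thesis"
  have "{(a, a'). a \<in> A \<and> a' \<in> A \<and> a \<noteq> a' \<and> heavy a a'} = ?R \<inter> A \<times> A" by auto
  moreover have "finite A" using A finite_N finite_subset by blast
  moreover have "sym ?R" by (auto simp: sym_def heavy_commute)
  ultimately obtain W where W: "W \<subseteq> A" "W \<noteq> {}"
    and deg: "\<And>a. a \<in> W \<Longrightarrow> 6 * k < card {w\<in>W. (a, w) \<in> ?R}"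
    using symmetric_min_degree[of A ?R "6 * k"] * by (auto simp: algebra_simps)
  obtain a\<^sub>0 where a0: "a\<^sub>0 \<in> W" using W(2) by auto
  show False
  proof (rule greedy_cycle[where p = "[a\<^sub>0, x]" and B = W and x = x and s = 0 and m = "k - 2"])
    show "rpath [a\<^sub>0, x]"
      using a0 W(1) A by (intro rpath_edge, subst adj_commute) auto
    show "length [a\<^sub>0, x] + 2 * Suc (k - 2) + 0 = 2 * k" using k_ge_2 by simp
    fix q assume q: "rpath q" "hd q \<in> W" "last q = x" "length q < 2 * k"
    let ?a = "hd q"
    have q0: "q \<noteq> []" using q(1) by (simp add: rainbow_path_def)
    have xq: "x \<in> set q" "?a \<in> set q" using q0 q(3) by auto
    have cq: "card (set q) \<le> 2 * k" "card (set (cols q)) \<le> 2 * k"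
      using card_path_le(1)[of q] card_path_le(2)[of col q] q(4) by linarith+
    have "{w\<in>W. (?a, w) \<in> ?R} \<subseteq> N x" using W(1) A by auto
    moreover have "6 * k < card {w\<in>W. (?a, w) \<in> ?R}" using deg q(2) by blast
    \<comment> \<open>The next vertex of \<open>W\<close> is chosen before the connector and as a
      neighbour of \<open>x\<close>, so that the closing edge \<open>x a\<close> has a colour new to
      the path.\<close>
    ultimately obtain a where a: "a \<in> W" "heavy ?a a" "a \<noteq> ?a" "a \<notin> set q" "col x a \<notin> set (cols q)"
      using avoid[of "{w\<in>W. (?a, w) \<in> ?R}" x "set q" "set (cols q)" "\<lambda>_. False" 0] cq by auto
    have xa: "adj x a" using a(1) W(1) A by auto
    let ?S = "N ?a \<inter> N a"
    \<comment> \<open>The closing colour is also forbidden on the edge from \<open>?a\<close> to the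
      connector; on \<open>a z\<close> properness at \<open>a\<close> excludes it. In total
      \<open>6 * k + 1 < 12 * k\<close> candidates are lost.\<close>
    let ?C = "insert (col x a) (set (cols q))"
    have "card {z\<in>?S. col a z \<in> set (cols q)} \<le> 2 * k"
      using card_forbidden_colours[of ?S a "set (cols q)"] cq by simp
    moreover have "card ?C \<le> Suc (2 * k)"
      using cq(2) by (simp add: card_insert_if)
    moreover have "12 * k \<le> card ?S" using a(2) by (simp add: heavy_def)
    ultimately obtain z where z: "adj ?a z" "adj a z" "z \<notin> set q" "col ?a z \<notin> ?C" "col a z \<notin> set (cols q)"
      using avoid[of ?S ?a "set q" ?C "\<lambda>z. col a z \<in> set (cols q)" "2 * k"] cq(1) k_ge_2 by auto
    have p1: "rpath (z # q)"
      using q0 z q(1) by (simp add: rainbow_path_Cons col_sym[of z] adj_commute[of z])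
    have "col a z \<noteq> col ?a z"
      using col_proper[of z a ?a] z(1,2) a(3) by (auto simp: col_sym[of z] adj_commute[of z])
    hence p2: "rpath (a # z # q)"
      using p1 z a adj_irrefl[of a] q0
      by (auto simp: rainbow_path_Cons[of "z # q"] path_cols_Cons col_sym[of z ?a])
    have ax: "adj a x" using xa by (rule adj_sym)
    hence "col a x \<noteq> col a z"
      using col_proper[of a x z] z(2,3) xq(1) by auto
    hence "col a x \<notin> set (cols (a # z # q))"
      using a(5) z(4) q0 col_sym[of a x] col_sym[of z ?a] by (auto simp: path_cols_Cons)
    thus "\<exists>z b t. b \<in> W \<and> length t = 0 \<and> rpath (t @ b # z # q) \<and>
        adj (hd (t @ [b])) x \<and> col (hd (t @ [b])) x \<notin> set (cols (t @ b # z # q))"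
      using a(1) p2 ax by (intro exI[of _ z] exI[of _ a]) auto
  qed (use a0 in auto)
qed

subsection \<open>Walks of length three\<close>

text \<open>Middle vertex first. Their number is the sum of the squared degrees, the unit in which
  exceptional walks of length three are counted.\<close>

definition cherries :: "('a \<times> 'a \<times> 'a) set" where
  "cherries = {(a, x, z). adj a x \<and> adj a z}"

lemma finite_cherries: "finite cherries"
  by (rule finite_subset[of _ "V \<times> V \<times> V"]) (auto simp: cherries_def finite_V dest: adj_V adj_V2)

lemma card_cherries_at: "card {s\<in>cherries. fst s = a} = card (N a) * card (N a)"
proof -
  have "{s\<in>cherries. fst s = a} = Pair a ` (N a \<times> N a)" by (auto simp: cherries_def)
  thus ?thesis by (simp add: card_image inj_on_def card_cartesian_product)
qed

lemma card_two_walks_from: "card {(b, y). adj v b \<and> adj b y} \<le> 12 * k * card V"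
proof -
  have "{(b, y). adj v b \<and> adj b y} = {(b, y). b \<in> N v \<and> y \<in> V \<and> adj b y}"
    by (auto dest: adj_V2)
  hence "card {(b, y). adj v b \<and> adj b y} \<le> 6 * k * (card (N v) + card V)"
    using edges_from_neighbourhood[of "N v" v V] finite_V by simp
  also have "\<dots> \<le> 12 * k * card V" using card_N_le[of v] by (simp add: algebra_simps)
  finally show ?thesis .
qed

lemma card_cherries_le: "card cherries \<le> 12 * k * card V * card V"
proof (rule card_le_fibres[where f = "\<lambda>(a, x, z). x"])
  fix x assume "x \<in> V"
  have "{s\<in>cherries. (\<lambda>(a, x, z). x) s = x} = (\<lambda>(a, z). (a, x, z)) ` {(a, z). adj x a \<and> adj a z}"
    by (auto simp: cherries_def image_iff adj_commute[of x])
  moreover have "card ((\<lambda>(a, z). (a, x, z)) ` {(a, z). adj x a \<and> adj a z}) =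
      card {(a, z). adj x a \<and> adj a z}"
    by (rule card_image) (auto simp: inj_on_def)
  ultimately show "card {s\<in>cherries. (\<lambda>(a, x, z). x) s = x} \<le> 12 * k * card V"
    using card_two_walks_from[of x] by simp
qed (use finite_cherries finite_V in \<open>auto simp: cherries_def dest: adj_V2\<close>)

definition three_walks :: "('a \<times> 'a \<times> 'a \<times> 'a) set" where
  "three_walks = {(x, a, b, y). adj x a \<and> adj a b \<and> adj b y}"

lemma finite_three_walks: "finite three_walks"
  by (rule finite_subset[of _ "V \<times> V \<times> V \<times> V"])
    (auto simp: three_walks_def finite_V dest: adj_V adj_V2)

text \<open>The colour conditions already exclude \<open>x = b\<close> and \<open>a = y\<close>;
  \<open>x = y\<close> remains possible.\<close>

definition light_walks :: "('a \<times> 'a \<times> 'a \<times> 'a) set" where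
  "light_walks = {(x, a, b, y) \<in> three_walks. \<not> heavy x b \<and> \<not> heavy a y \<and>
     col x a \<noteq> col a b \<and> col a b \<noteq> col b y \<and> col x a \<noteq> col b y}"

lemma finite_light_walks: "finite light_walks"
  using finite_three_walks by (rule finite_subset[rotated]) (auto simp: light_walks_def)

text \<open>For fixed \<open>a\<close> there are \<open>card (N a)\<close> choices of
  \<open>x\<close> and, by \<open>edges_to_heavy\<close>, at most \<open>12 * k * card (N a)\<close>
  of \<open>(b, y)\<close>.\<close>

lemma card_three_walks_heavy_end:
  "card {(x, a, b, y) \<in> three_walks. heavy a y} \<le> 12 * k * card cherries"
proof -
  let ?H = "{(x, a, b, y) \<in> three_walks. heavy a y}"
  have "1 * card ?H \<le> 12 * k * card cherries"
  proof (rule card_mult_le_fibrewise[where f = "\<lambda>(x, a, b, y). a" and g = fst])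
    show "finite ?H" using finite_three_walks by (rule finite_subset[rotated]) auto
    fix a
    let ?Q = "{(b, y). adj a b \<and> adj b y \<and> heavy a y}"
    have "{s\<in>?H. (\<lambda>(x, a, b, y). a) s = a} = (\<lambda>(x, b, y). (x, a, b, y)) ` (N a \<times> ?Q)"
      by (auto simp: three_walks_def image_iff adj_commute[of a])
    hence "card {s\<in>?H. (\<lambda>(x, a, b, y). a) s = a} = card (N a \<times> ?Q)"
      by (simp only:) (rule card_image, auto simp: inj_on_def)
    also have "\<dots> = card (N a) * card ?Q" by (rule card_cartesian_product)
    also have "\<dots> \<le> card (N a) * (12 * k * card (N a))"
      by (intro mult_left_mono edges_to_heavy) auto
    also have "\<dots> = 12 * k * card {s\<in>cherries. fst s = a}"
      by (simp add: card_cherries_at)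
    finally show "1 * card {s\<in>?H. (\<lambda>(x, a, b, y). a) s = a} \<le> 12 * k * card {s\<in>cherries. fst s = a}"
      by simp
  qed (rule finite_cherries)
  thus ?thesis by simp
qed

lemma card_three_walks_heavy_start:
  "card {(x, a, b, y) \<in> three_walks. heavy x b} \<le> 12 * k * card cherries"
proof -
  let ?r = "\<lambda>(x, a, b, y). (y, b, a, x)"
  let ?H = "{(x, a, b, y) \<in> three_walks. heavy a y}"
  have "{(x, a, b, y) \<in> three_walks. heavy x b} \<subseteq> ?r ` ?H"
    by (auto simp: three_walks_def image_iff heavy_commute adj_commute)
  moreover have "finite ?H" using finite_three_walks by (rule finite_subset[rotated]) auto
  ultimately have "card {(x, a, b, y) \<in> three_walks. heavy x b} \<le> card ?H"
    by (rule surj_card_le[rotated])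
  thus ?thesis using card_three_walks_heavy_end by simp
qed

text \<open>The equality makes one end redundant: it forces \<open>x = b\<close>, respectively
  \<open>y = a\<close>, and in the third case \<open>y\<close> is the neighbour of \<open>b\<close>
  along the colour of \<open>x a\<close>.\<close>

lemma card_three_walks_repeated_colour:
  "card {(x, a, b, y) \<in> three_walks. col x a = col a b} \<le> card cherries"
  "card {(x, a, b, y) \<in> three_walks. col a b = col b y} \<le> card cherries"
  "card {(x, a, b, y) \<in> three_walks. col x a = col b y} \<le> card cherries"
proof -
  have eq1: "x = b" if "adj x a" "adj a b" "col x a = col a b" for x a b
    using that col_proper[of a x b] by (simp add: col_sym[of x] adj_commute[of x])
  show "card {(x, a, b, y) \<in> three_walks. col x a = col a b} \<le> card cherries"
  proof (rule card_inj_on_le[where f = "\<lambda>(x, a, b, y). (b, a, y)"])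
    show "inj_on (\<lambda>(x, a, b, y). (b, a, y)) {(x, a, b, y) \<in> three_walks. col x a = col a b}"
      by (rule inj_onI) (clarsimp simp: three_walks_def, metis eq1)
  qed (auto simp: three_walks_def cherries_def finite_cherries[unfolded cherries_def]
        adj_commute)
  show "card {(x, a, b, y) \<in> three_walks. col a b = col b y} \<le> card cherries"
  proof (rule card_inj_on_le[where f = "\<lambda>(x, a, b, y). (a, x, b)"])
    show "inj_on (\<lambda>(x, a, b, y). (a, x, b)) {(x, a, b, y) \<in> three_walks. col a b = col b y}"
      by (rule inj_onI) (clarsimp simp: three_walks_def, metis eq1)
  qed (auto simp: three_walks_def cherries_def finite_cherries[unfolded cherries_def]
        adj_commute)
  show "card {(x, a, b, y) \<in> three_walks. col x a = col b y} \<le> card cherries"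
  proof (rule card_inj_on_le[where f = "\<lambda>(x, a, b, y). (a, x, b)"])
    show "inj_on (\<lambda>(x, a, b, y). (a, x, b)) {(x, a, b, y) \<in> three_walks. col x a = col b y}"
      by (rule inj_onI) (clarsimp simp: three_walks_def, metis col_proper)
  qed (auto simp: three_walks_def cherries_def finite_cherries[unfolded cherries_def]
        adj_commute)
qed

lemma card_three_walks_le_light:
  "card three_walks \<le> card light_walks + (24 * k + 3) * card cherries"
proof -
  let ?A = "{(x, a, b, y) \<in> three_walks. heavy a y}"
  let ?B = "{(x, a, b, y) \<in> three_walks. heavy x b}"
  let ?C = "{(x, a, b, y) \<in> three_walks. col x a = col a b}"
  let ?D = "{(x, a, b, y) \<in> three_walks. col a b = col b y}"
  let ?E = "{(x, a, b, y) \<in> three_walks. col x a = col b y}"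
  have "three_walks \<subseteq> light_walks \<union> (?A \<union> (?B \<union> (?C \<union> (?D \<union> ?E))))"
    by (auto simp: light_walks_def)
  moreover have "finite (light_walks \<union> (?A \<union> (?B \<union> (?C \<union> (?D \<union> ?E)))))"
    by (simp only: finite_Un finite_light_walks)
      (intro conjI TrueI; rule finite_subset[OF _ finite_three_walks]; auto)
  ultimately have "card three_walks \<le> card (light_walks \<union> (?A \<union> (?B \<union> (?C \<union> (?D \<union> ?E)))))"
    by (rule card_mono[rotated])
  also have "\<dots> \<le> card light_walks + (card ?A + (card ?B + (card ?C + (card ?D + card ?E))))"
    by (intro order_trans[OF card_Un_le] add_left_mono order_refl)
  also have "\<dots> \<le> card light_walks + (12 * k * card cherries + (12 * k * card cherries +
      (card cherries + (card cherries + card cherries))))"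
    by (intro add_left_mono add_mono card_three_walks_heavy_end card_three_walks_heavy_start
        card_three_walks_repeated_colour)
  finally show ?thesis by (simp add: algebra_simps)
qed

section \<open>Parallel walks: equal ends and equal middle colour\<close>

definition walk_key :: "'a \<times> 'a \<times> 'a \<times> 'a \<Rightarrow> 'a \<times> 'a \<times> 'c" where
  "walk_key = (\<lambda>(x, a, b, y). (x, y, col a b))"

text \<open>Ordered pairs with the diagonal, so their number is the sum of the squared class sizes
  of \<open>walk_key\<close>.\<close>

definition parallel_walks :: "(('a \<times> 'a \<times> 'a \<times> 'a) \<times> ('a \<times> 'a \<times> 'a \<times> 'a)) set" where
  "parallel_walks = {(p, q). p \<in> light_walks \<and> q \<in> light_walks \<and> walk_key p = walk_key q}"

lemma finite_parallel_walks: "finite parallel_walks"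
  by (rule finite_subset[of _ "light_walks \<times> light_walks"])
    (auto simp: parallel_walks_def finite_light_walks)

lemma light_walk_adj:
  assumes "(x, a, b, y) \<in> light_walks"
  shows "adj x a" "adj a b" "adj b y" "adj a x" "adj b a" "adj y b"
  using assms adj_commute by (auto simp: light_walks_def three_walks_def)

lemma light_walk_rev: "(x, a, b, y) \<in> light_walks \<Longrightarrow> (y, b, a, x) \<in> light_walks"
  by (auto simp: light_walks_def three_walks_def adj_commute heavy_commute col_sym)

text \<open>For a fixed key, \<open>a\<close> determines \<open>b\<close> through the middle colour,
  so a pair of walks is determined by \<open>(a, a')\<close>. All these vertices are neighbours of
  \<open>x\<close>, and \<open>heavy_pairs_in_neighbourhood\<close> applies.\<close>

lemma card_parallel_heavy:
  "card {((x, a, b, y), (x', a', b', y')) \<in> parallel_walks. a \<noteq> a' \<and> heavy a a'}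
     \<le> 12 * k * card light_walks" (is "card ?P \<le> _")
proof -
  have "1 * card ?P \<le> 12 * k * card light_walks"
  proof (rule card_mult_le_fibrewise[where f = "\<lambda>(p, q). walk_key p" and g = walk_key])
    show "finite ?P" using finite_parallel_walks by (rule finite_subset[rotated]) auto
    fix \<kappa> :: "'a \<times> 'a \<times> 'c"
    obtain x y c where \<kappa>: "\<kappa> = (x, y, c)" by (cases \<kappa>)
    define L where "L = {p\<in>light_walks. walk_key p = \<kappa>}"
    define A where "A = (\<lambda>(x, a, b, y). a) ` L"
    have fL: "finite L" unfolding L_def using finite_light_walks by simp
    have inj: "b = b'" if "(x, a, b, y) \<in> L" "(x, a, b', y) \<in> L" for a b b'
      using that by (auto simp: L_def walk_key_def \<kappa> dest!: light_walk_adj(2) intro: col_proper)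
    have A_I: "a \<in> A" if "(x, a, b, y) \<in> L" for x a b y
      using that by (force simp: A_def)
    have fA: "finite A" by (simp add: A_def fL)
    have AN: "A \<subseteq> N x"
      by (auto simp: A_def L_def walk_key_def \<kappa> dest: light_walk_adj(1))
    have "card {s\<in>?P. (\<lambda>(p, q). walk_key p) s = \<kappa>}
        \<le> card {(a, a'). a \<in> A \<and> a' \<in> A \<and> a \<noteq> a' \<and> heavy a a'}"
    proof (rule card_inj_on_le[where f = "\<lambda>((x, a, b, y), (x', a', b', y')). (a, a')"])
      show "inj_on (\<lambda>((x, a, b, y), (x', a', b', y')). (a, a')) {s\<in>?P. (\<lambda>(p, q). walk_key p) s = \<kappa>}"
      proof (rule inj_onI)
        let ?F = "{s\<in>?P. (\<lambda>(p, q). walk_key p) s = \<kappa>}"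
        fix s t assume st: "s \<in> ?F" "t \<in> ?F"
          and eq: "(\<lambda>((x, a, b, y), (x', a', b', y')). (a, a')) s = (\<lambda>((x, a, b, y), (x', a', b', y')). (a, a')) t"
        have *: "\<exists>a b a' b'. s = ((x, a, b, y), (x, a', b', y)) \<and> (x, a, b, y) \<in> L \<and> (x, a', b', y) \<in> L"
          if "s \<in> ?F" for s
          using that by (auto simp: parallel_walks_def walk_key_def L_def \<kappa>)
        from *[OF st(1)] *[OF st(2)] eq show "s = t" by (auto dest: inj)
      qed
      show "(\<lambda>((x, a, b, y), (x', a', b', y')). (a, a')) ` {s\<in>?P. (\<lambda>(p, q). walk_key p) s = \<kappa>}
          \<subseteq> {(a, a'). a \<in> A \<and> a' \<in> A \<and> a \<noteq> a' \<and> heavy a a'}"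
        by (auto intro!: A_I simp: L_def parallel_walks_def walk_key_def \<kappa>)
      show "finite {(a, a'). a \<in> A \<and> a' \<in> A \<and> a \<noteq> a' \<and> heavy a a'}"
        by (rule finite_subset[of _ "A \<times> A"]) (auto simp: fA)
    qed
    also have "\<dots> \<le> 12 * k * card A" by (rule heavy_pairs_in_neighbourhood[OF AN])
    also have "\<dots> \<le> 12 * k * card L"
      unfolding A_def by (intro mult_left_mono card_image_le fL) auto
    finally show "1 * card {s\<in>?P. (\<lambda>(p, q). walk_key p) s = \<kappa>}
        \<le> 12 * k * card {p\<in>light_walks. walk_key p = \<kappa>}"
      by (simp add: L_def)
  qed (rule finite_light_walks)
  thus ?thesis by simp
qed

text \<open>Reversing both walks exchanges the roles of \<open>a\<close> and
  \<open>b\<close>.\<close>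

lemma card_parallel_heavy':
  "card {((x, a, b, y), (x', a', b', y')) \<in> parallel_walks. b \<noteq> b' \<and> heavy b b'}
     \<le> 12 * k * card light_walks" (is "card ?P \<le> _")
proof -
  let ?Q = "{((x, a, b, y), (x', a', b', y')) \<in> parallel_walks. a \<noteq> a' \<and> heavy a a'}"
  have "?P \<subseteq> (\<lambda>((x, a, b, y), (x', a', b', y')). ((y, b, a, x), (y', b', a', x'))) ` ?Q"
    by (auto simp: parallel_walks_def walk_key_def image_iff col_sym dest: light_walk_rev)
  moreover have "finite ?Q"
    using finite_parallel_walks by (rule finite_subset[rotated]) auto
  ultimately have "card ?P \<le> card ?Q" by (rule surj_card_le[rotated])
  thus ?thesis using card_parallel_heavy by (rule order_trans)
qed

text \<open>The six vertices \<open>x a b y b' a'\<close> form a closed walk in which \<open>a b\<close> and \<open>a' b'\<close> have the same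
  colour. Rotating it exhibits the light walk \<open>a b y b'\<close>, which determines \<open>a'\<close>.\<close>

lemma card_parallel_light:
  "card {((x, a, b, y), (x', a', b', y')) \<in> parallel_walks. a \<noteq> a' \<and> \<not> heavy a a' \<and> \<not> heavy b b'}
     \<le> 12 * k * card light_walks" (is "card ?P \<le> _")
proof (rule card_le_fibres[where f = "\<lambda>((x, a, b, y), (x', a', b', y')). (a, b, y, b')"])
  let ?f = "\<lambda>((x, a, b, y), (x', a', b', y')). (a, b, y, b')"
  show "finite ?P" using finite_parallel_walks by (rule finite_subset[rotated]) auto
  show "?f ` ?P \<subseteq> light_walks"
  proof (clarsimp simp: parallel_walks_def walk_key_def)
    fix x a b y a' b'
    assume p: "(x, a, b, y) \<in> light_walks" and q: "(x, a', b', y) \<in> light_walks"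
      and c: "col a b = col a' b'" "a \<noteq> a'" and l: "\<not> heavy b b'"
    note adj = light_walk_adj[OF p] light_walk_adj[OF q]
    have bb: "b \<noteq> b'"
      using c adj col_proper[of b a a'] by (auto simp: col_sym)
    hence "col b y \<noteq> col y b'"
      using adj col_proper[of y b b'] by (auto simp: col_sym[of b y])
    \<comment> \<open>This comes from the second walk, whose middle edge has the colour of
      \<open>a b\<close>.\<close>
    moreover have "col a b \<noteq> col y b'"
      using q c(1) by (auto simp: light_walks_def col_sym[of y b'])
    ultimately show "(a, b, y, b') \<in> light_walks"
      using p adj l by (auto simp: light_walks_def three_walks_def)
  qed
  fix t assume "t \<in> light_walks"
  obtain a b y b' where t: "t = (a, b, y, b')" by (cases t)
  let ?S = "{s\<in>?P. ?f s = t}"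
  show "card ?S \<le> 12 * k"
  proof (cases "?S = {}")
    case False
    then obtain s where s: "s \<in> ?S" by blast
    then obtain x\<^sub>0 a' where s': "s = ((x\<^sub>0, a, b, y), (x\<^sub>0, a', b', y))"
      by (auto simp: t parallel_walks_def walk_key_def)
    have q0: "adj b' a'" "col b' a' = col a b" "\<not> heavy a a'"
      using s light_walk_adj[of x\<^sub>0 a' b' y]
      by (auto simp: s' t parallel_walks_def walk_key_def col_sym[of b'])
    \<comment> \<open>Within the fibre \<open>a'\<close> is fixed as the neighbour of
      \<open>b'\<close> along the colour of \<open>a b\<close>. Only \<open>x\<close> varies, among
      the common neighbours of the pair \<open>a\<close>, \<open>a'\<close>, which is not
      heavy.\<close>
    have "?S \<subseteq> (\<lambda>x. ((x, a, b, y), (x, a', b', y))) ` (N a \<inter> N a')"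
    proof
      fix u assume u: "u \<in> ?S"
      then obtain x e where u': "u = ((x, a, b, y), (x, e, b', y))"
        by (auto simp: t parallel_walks_def walk_key_def)
      have "(x, a, b, y) \<in> light_walks" "(x, e, b', y) \<in> light_walks" "col a b = col e b'"
        using u by (auto simp: u' t parallel_walks_def walk_key_def)
      moreover from this have "e = a'"
        using col_proper[of b' e a'] q0 light_walk_adj(5)[of x e b' y] by (auto simp: col_sym[of b'])
      ultimately show "u \<in> (\<lambda>x. ((x, a, b, y), (x, a', b', y))) ` (N a \<inter> N a')"
        using light_walk_adj(4) by (auto simp: u')
    qed
    hence "card ?S \<le> card (N a \<inter> N a')"
      by (rule surj_card_le[rotated]) auto
    thus ?thesis using q0(3) by (simp add: heavy_def)
  qed (simp only: card.empty)
qed (rule finite_light_walks)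

lemma card_parallel_walks_le: "card parallel_walks \<le> (36 * k + 1) * card light_walks"
proof -
  let ?A = "{((x, a, b, y), (x', a', b', y')) \<in> parallel_walks. a \<noteq> a' \<and> heavy a a'}"
  let ?B = "{((x, a, b, y), (x', a', b', y')) \<in> parallel_walks. b \<noteq> b' \<and> heavy b b'}"
  let ?C = "{((x, a, b, y), (x', a', b', y')) \<in> parallel_walks. a \<noteq> a' \<and> \<not> heavy a a' \<and> \<not> heavy b b'}"
  let ?D = "(\<lambda>p. (p, p)) ` light_walks"
  have "parallel_walks \<subseteq> ?D \<union> (?A \<union> (?B \<union> ?C))"
  proof
    fix s assume s: "s \<in> parallel_walks"
    then obtain x a b y a' b' where s': "s = ((x, a, b, y), (x, a', b', y))"
      by (auto simp: parallel_walks_def walk_key_def)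
    have p: "(x, a, b, y) \<in> light_walks" and q: "(x, a', b', y) \<in> light_walks"
      and c: "col a b = col a' b'"
      using s by (auto simp: s' parallel_walks_def walk_key_def)
    \<comment> \<open>By properness a pair off the diagonal differs in both middle vertices and so
      lies in \<open>?A\<close>, \<open>?B\<close> or \<open>?C\<close>.\<close>
    have "a = a' \<longleftrightarrow> b = b'"
      using c light_walk_adj[OF p] light_walk_adj[OF q] col_proper[of a b b'] col_proper[of b a a']
      by (auto simp: col_sym)
    thus "s \<in> ?D \<union> (?A \<union> (?B \<union> ?C))"
      using s p by (auto simp: s')
  qed
  moreover have "finite (?D \<union> (?A \<union> (?B \<union> ?C)))"
    by (simp only: finite_Un finite_imageI finite_light_walks)
      (intro conjI TrueI; rule finite_subset[OF _ finite_parallel_walks]; auto)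
  ultimately have "card parallel_walks \<le> card (?D \<union> (?A \<union> (?B \<union> ?C)))"
    by (rule card_mono[rotated])
  also have "\<dots> \<le> card ?D + (card ?A + (card ?B + card ?C))"
    by (intro order_trans[OF card_Un_le] add_left_mono order_refl)
  also have "\<dots> \<le> card light_walks + (12 * k * card light_walks + (12 * k * card light_walks +
      12 * k * card light_walks))"
    by (intro add_mono card_parallel_heavy card_parallel_heavy' card_parallel_light card_image_le
        finite_light_walks)
  finally show ?thesis by (simp add: algebra_simps)
qed

text \<open>The threshold is twice \<open>36 * k + 1\<close>, the bound on the average class size
  that \<open>card_parallel_walks_le\<close> gives.\<close>

definition colour_light_walks :: "('a \<times> 'a \<times> 'a \<times> 'a) set" where
  "colour_light_walks = {p\<in>light_walks. card {q\<in>light_walks. walk_key q = walk_key p} < 72 * k + 2}"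

lemma colour_light_subset: "colour_light_walks \<subseteq> light_walks"
  by (auto simp: colour_light_walks_def)

text \<open>Markov's inequality: every other light walk is the first component of at least
  \<open>72 * k + 2\<close> parallel pairs, so these walks make up at most half.\<close>

lemma card_light_walks_le: "card light_walks \<le> 2 * card colour_light_walks"
proof -
  let ?H = "light_walks - colour_light_walks"
  have "(72 * k + 2) * card ?H \<le> 1 * card parallel_walks"
  proof (rule card_mult_le_fibrewise[where f = walk_key and g = "\<lambda>(p, q). walk_key p"])
    fix \<kappa> assume "\<kappa> \<in> walk_key ` ?H"
    then obtain p where p: "p \<in> ?H" "\<kappa> = walk_key p" by blast
    let ?L = "{q\<in>light_walks. walk_key q = \<kappa>}"
    have big: "72 * k + 2 \<le> card ?L"
      using p by (auto simp: colour_light_walks_def)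
    \<comment> \<open>Membership depends on the key alone, so this class lies in \<open>?H\<close>
      as a whole.\<close>
    have "{s\<in>?H. walk_key s = \<kappa>} = ?L"
      using big by (auto simp: colour_light_walks_def)
    moreover have "{t\<in>parallel_walks. (\<lambda>(p, q). walk_key p) t = \<kappa>} = ?L \<times> ?L"
      by (auto simp: parallel_walks_def)
    ultimately show "(72 * k + 2) * card {s\<in>?H. walk_key s = \<kappa>}
        \<le> 1 * card {t\<in>parallel_walks. (\<lambda>(p, q). walk_key p) t = \<kappa>}"
      using mult_right_mono[OF big, of "card ?L"] by (simp only: card_cartesian_product mult_1)
  qed (use finite_light_walks finite_parallel_walks in auto)
  also have "\<dots> \<le> (36 * k + 1) * card light_walks"
    using card_parallel_walks_le by simp
  finally have "(36 * k + 1) * (2 * card ?H) \<le> (36 * k + 1) * card light_walks"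
    by (simp add: algebra_simps)
  hence "2 * card ?H \<le> card light_walks" by (subst (asm) mult_le_cancel1) auto
  moreover have "card ?H = card light_walks - card colour_light_walks"
    by (rule card_Diff_subset) (use finite_light_walks finite_subset colour_light_subset in blast)+
  ultimately show ?thesis by linarith
qed

text \<open>Otherwise a greedy path starting with \<open>x\<close>, \<open>a\<^sub>0\<close>,
  \<open>b\<^sub>0\<close> runs along a part \<open>R\<close> of large minimum degree and returns to
  \<open>x\<close> through the second vertex of a colour-light walk.\<close>

lemma card_last_edges_le:
  assumes "3 \<le> k"
  shows "card {(b, y). \<exists>a. (x, a, b, y) \<in> colour_light_walks} \<le> (192 * k * k + 20 * k) * (card V + card V)"
proof (rule ccontr)
  let ?E = "{(b, y). \<exists>a. (x, a, b, y) \<in> colour_light_walks}"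
  \<comment> \<open>At most \<open>12 * k * (2 * k + 1) + (72 * k + 2) * (2 * k) + 12 * k * (2 *
    k)\<close> choices of \<open>b\<close> have a bad middle vertex, and \<open>4 * k\<close> more
    are lost to vertices and colours at \<open>b\<close> itself.\<close>
  let ?D = "192 * k * k + 20 * k"
  assume "\<not> ?thesis"
  hence "?D * (card V + card V) < card ?E" by simp
  moreover have "?E \<subseteq> V \<times> V"
    using colour_light_subset light_walk_adj(3) adj_V adj_V2 by blast
  ultimately have "\<exists>R\<subseteq>?E. R \<noteq> {} \<and> (\<forall>(b, y)\<in>R. ?D < card (R `` {b}) \<and> ?D < card (R\<inverse> `` {y}))"
    using finite_V by (intro bipartite_min_degree[of V V])
  then obtain R where R: "R \<subseteq> ?E" "R \<noteq> {}"
    and deg': "\<forall>(b, y)\<in>R. ?D < card (R `` {b}) \<and> ?D < card (R\<inverse> `` {y})"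
    by blast
  have deg: "?D < card (R `` {b})" "?D < card (R\<inverse> `` {y})" if "(b, y) \<in> R" for b y
    using deg' that by auto
  have walk: "\<exists>a. (x, a, b, y) \<in> colour_light_walks" if "(b, y) \<in> R" for b y
    using R(1) that by blast
  have Radj: "adj b y" "adj y b" if "(b, y) \<in> R" for b y
    using walk[OF that] colour_light_subset light_walk_adj(3,6) by blast+
  obtain b\<^sub>0 y\<^sub>0 where R0: "(b\<^sub>0, y\<^sub>0) \<in> R" using R(2) by auto
  then obtain a\<^sub>0 where "(x, a\<^sub>0, b\<^sub>0, y\<^sub>0) \<in> light_walks"
    using walk colour_light_subset by blast
  note w0 = this light_walk_adj[OF this]
  have start: "rpath [b\<^sub>0, a\<^sub>0, x]"
  proof -
    have "col b\<^sub>0 a\<^sub>0 \<noteq> col a\<^sub>0 x"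
      using w0(1) by (auto simp: light_walks_def col_sym)
    moreover from this have "b\<^sub>0 \<noteq> x" using col_sym by metis
    ultimately show ?thesis
      using w0 adj_irrefl by (auto simp: rainbow_path_def)
  qed
  show False
  \<comment> \<open>Three initial vertices, \<open>k - 2\<close> rounds of two and one closing
    vertex make \<open>2 * k\<close>. The induction takes at least one round, so
    \<open>3 \<le> k\<close> enters here.\<close>
  proof (rule greedy_cycle[where p = "[b\<^sub>0, a\<^sub>0, x]" and B = "Domain R" and x = x and s = 1 and m = "k - 3"])
    show "length [b\<^sub>0, a\<^sub>0, x] + 2 * Suc (k - 3) + 1 = 2 * k" using assms by simp
    show "hd [b\<^sub>0, a\<^sub>0, x] \<in> Domain R" using R0 by auto
    fix q assume q: "rpath q" "hd q \<in> Domain R" "last q = x" "length q < 2 * k"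
    let ?b = "hd q"
    have q0: "q \<noteq> []" using q(1) by (simp add: rainbow_path_def)
    have cq: "card (set q) \<le> 2 * k" "card (set (cols q)) \<le> 2 * k"
      using card_path_le(1)[of q] card_path_le(2)[of col q] q(4) by linarith+
    have "R `` {?b} \<subseteq> N ?b" using Radj by auto
    moreover have "?D < card (R `` {?b})" using q(2) deg by auto
    ultimately obtain y where y: "(?b, y) \<in> R" "y \<notin> set q" "col ?b y \<notin> set (cols q)"
      using avoid[of "R `` {?b}" ?b "set q" "set (cols q)" "\<lambda>_. False" 0] cq by auto
    have p1: "rpath (y # q)"
      using q0 y q(1) Radj(2)[OF y(1)] by (simp add: rainbow_path_Cons col_sym[of y])
    let ?C = "set (cols (y # q))" and ?F = "insert y (set q)"
    have c1: "card ?C \<le> 2 * k"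
      using card_path_le(2)[of col "y # q"] q(4) by simp
    have cF: "card ?F \<le> 2 * k + 1"
      using cq(1) by (simp add: card_insert_if)
    define S where "S = R\<inverse> `` {y}"
    have S: "b \<in> S \<longleftrightarrow> (b, y) \<in> R" for b by (simp add: S_def)
    have dS: "?D < card S" unfolding S_def by (rule deg(2)[OF y(1)])
    have fS: "finite S" using dS card_ge_0_finite[of S] by linarith
    \<comment> \<open>For each candidate \<open>b\<close> one vertex is fixed that completes
      \<open>b y\<close> to a colour-light walk from \<open>x\<close>; it will close the
      cycle.\<close>
    define \<alpha> where "\<alpha> b = (SOME a. (x, a, b, y) \<in> colour_light_walks)" for b
    have \<alpha>: "(x, \<alpha> b, b, y) \<in> colour_light_walks" if "b \<in> S" for b
      using that unfolding \<alpha>_def S by (rule someI_ex[OF walk])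
    have \<alpha>l: "(x, \<alpha> b, b, y) \<in> light_walks" if "b \<in> S" for b
      using \<alpha>[OF that] colour_light_subset by blast
    \<comment> \<open>These \<open>b\<close> are common neighbours of \<open>a\<close> and
      \<open>y\<close>, which are not a heavy pair.\<close>
    have fib: "card {b\<in>S. \<alpha> b = a} \<le> 12 * k" for a
    proof (cases "{b\<in>S. \<alpha> b = a} = {}")
      case False
      then obtain b where "b \<in> S" "\<alpha> b = a" by blast
      hence "\<not> heavy a y" using \<alpha>l[of b] by (auto simp: light_walks_def)
      moreover have "{b\<in>S. \<alpha> b = a} \<subseteq> N a \<inter> N y"
        using light_walk_adj(2,6)[OF \<alpha>l] by auto
      hence "card {b\<in>S. \<alpha> b = a} \<le> card (N a \<inter> N y)" by (intro card_mono) auto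
      ultimately show ?thesis by (simp add: heavy_def)
    qed (simp only: card.empty)
    \<comment> \<open>The middle vertex, its edge to \<open>b\<close>, or its edge to
      \<open>x\<close> may clash with the path. Each forbidden vertex is handled by
      \<open>fib\<close>; a forbidden colour on the edge to \<open>b\<close> fixes the key, so
      colour lightness applies; one on the edge to \<open>x\<close> fixes the middle vertex, and
      \<open>fib\<close> applies again.\<close>
    let ?S1 = "{b\<in>S. \<alpha> b \<in> ?F}" and ?S2 = "{b\<in>S. col (\<alpha> b) b \<in> ?C}" and ?S3 = "{b\<in>S. col x (\<alpha> b) \<in> ?C}"
    have "card ?S1 \<le> 12 * k * card ?F"
    proof (rule card_le_fibres[where f = \<alpha>])
      fix a
      have "{s\<in>?S1. \<alpha> s = a} \<subseteq> {b\<in>S. \<alpha> b = a}" by blast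
      thus "card {s\<in>?S1. \<alpha> s = a} \<le> 12 * k"
        using fS by (intro order_trans[OF card_mono fib[of a]]) auto
    qed (use fS in auto)
    moreover have "card ?S2 \<le> (72 * k + 2) * card ?C"
    proof (rule card_le_fibres[where f = "\<lambda>b. col (\<alpha> b) b"])
      fix c
      let ?T = "{s\<in>?S2. col (\<alpha> s) s = c}"
      show "card ?T \<le> 72 * k + 2"
      proof (cases "?T = {}")
        case False
        then obtain b where b: "b \<in> S" "col (\<alpha> b) b = c" by blast
        have "card ?T \<le> card {q\<in>light_walks. walk_key q = walk_key (x, \<alpha> b, b, y)}"
          using b(2) \<alpha>l finite_light_walks
          by (intro card_inj_on_le[where f = "\<lambda>b. (x, \<alpha> b, b, y)"]) (auto simp: inj_on_def walk_key_def)
        thus ?thesis using \<alpha>[OF b(1)] by (simp add: colour_light_walks_def)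
      qed (simp only: card.empty)
    qed (use fS in auto)
    moreover have "card ?S3 \<le> 12 * k * card ?C"
    proof (rule card_le_fibres[where f = "\<lambda>b. col x (\<alpha> b)"])
      fix c
      let ?T = "{s\<in>?S3. col x (\<alpha> s) = c}"
      show "card ?T \<le> 12 * k"
      proof (cases "?T = {}")
        case False
        then obtain b where b: "b \<in> S" "col x (\<alpha> b) = c" by blast
        have "\<alpha> b' = \<alpha> b" if "b' \<in> ?T" for b'
          using that b light_walk_adj(1)[OF \<alpha>l] col_proper[of x "\<alpha> b'" "\<alpha> b"] by auto
        hence "?T \<subseteq> {b'\<in>S. \<alpha> b' = \<alpha> b}" by blast
        thus ?thesis
          using fS by (intro order_trans[OF card_mono fib[of "\<alpha> b"]]) auto
      qed (simp only: card.empty)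
    qed (use fS in auto)
    ultimately have "card ?S1 + (card ?S2 + card ?S3)
        \<le> 12 * k * card ?F + ((72 * k + 2) * card ?C + 12 * k * card ?C)"
      by linarith
    also have "\<dots> \<le> 12 * k * (2 * k + 1) + ((72 * k + 2) * (2 * k) + 12 * k * (2 * k))"
      using cF c1 by (intro add_mono mult_left_mono) auto
    finally have "card ?S1 + (card ?S2 + card ?S3) \<le> 192 * k * k + 16 * k"
      by (simp add: algebra_simps)
    moreover have "card {b\<in>S. b \<in> ?S1 \<union> (?S2 \<union> ?S3)} \<le> card (?S1 \<union> (?S2 \<union> ?S3))"
      using fS by (intro card_mono) auto
    moreover have "card (?S1 \<union> (?S2 \<union> ?S3)) \<le> card ?S1 + (card ?S2 + card ?S3)"
      by (intro order_trans[OF card_Un_le] add_left_mono order_refl)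
    ultimately have "card {b\<in>S. b \<in> ?S1 \<union> (?S2 \<union> ?S3)} \<le> 192 * k * k + 16 * k"
      by linarith
    moreover have "S \<subseteq> N y" using Radj by (auto simp: S)
    ultimately have "\<exists>b\<in>S. b \<notin> set q \<and> col y b \<notin> ?C \<and> b \<notin> ?S1 \<union> (?S2 \<union> ?S3)"
      using cq c1 dS by (intro avoid[where e = "192 * k * k + 16 * k"]) auto
    then obtain b where b: "b \<in> S" "b \<notin> set q" "col y b \<notin> ?C"
      "\<alpha> b \<notin> ?F" "col (\<alpha> b) b \<notin> ?C" "col x (\<alpha> b) \<notin> ?C"
      by blast
    note w = \<alpha>l[OF b(1)] light_walk_adj[OF \<alpha>l[OF b(1)]]
    have "b \<noteq> y" "\<alpha> b \<noteq> b" using w adj_irrefl by metis+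
    have dc: "col x (\<alpha> b) \<noteq> col (\<alpha> b) b" "col (\<alpha> b) b \<noteq> col b y" "col x (\<alpha> b) \<noteq> col b y"
      using w(1) by (auto simp: light_walks_def)
    have "rpath (b # y # q)"
      using p1 b(2,3) w(4) \<open>b \<noteq> y\<close> by (simp add: rainbow_path_Cons[of "y # q"] col_sym[of b y])
    hence "rpath (\<alpha> b # b # y # q)"
      using b(4,5) w(3) \<open>\<alpha> b \<noteq> b\<close> dc by (simp add: rainbow_path_Cons[of "b # y # q"])
    moreover have "col (\<alpha> b) x \<notin> set (cols (\<alpha> b # b # y # q))"
      using dc b(6) by (simp add: col_sym[of "\<alpha> b" x])
    ultimately show "\<exists>z b t. b \<in> Domain R \<and> length t = 1 \<and> rpath (t @ b # z # q) \<and>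
        adj (hd (t @ [b])) x \<and> col (hd (t @ [b])) x \<notin> set (cols (t @ b # z # q))"
      using b(1) S w by (intro exI[of _ y] exI[of _ b] exI[of _ "[\<alpha> b]"]) auto
  qed (use start in auto)
qed

text \<open>For given \<open>x\<close> and last edge \<open>(b, y)\<close>, the vertex
  \<open>a\<close> is a common neighbour of \<open>x\<close> and \<open>b\<close>, which are not a
  heavy pair.\<close>

lemma card_colour_light_walks_le:
  assumes "3 \<le> k"
  shows "card colour_light_walks \<le> 12 * k * ((192 * k * k + 20 * k) * (card V + card V)) * card V"
proof (rule card_le_fibres[where f = fst])
  have fin: "finite colour_light_walks"
    using finite_light_walks finite_subset colour_light_subset by blast
  thus "finite colour_light_walks" .
  show "fst ` colour_light_walks \<subseteq> V"
    using colour_light_subset light_walk_adj(1) adj_V by fastforce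
  fix x assume "x \<in> V"
  let ?E = "{(b, y). \<exists>a. (x, a, b, y) \<in> colour_light_walks}"
  let ?S = "{s\<in>colour_light_walks. fst s = x}"
  have "card ?S \<le> 12 * k * card ?E"
  proof (rule card_le_fibres[where f = "\<lambda>(x, a, b, y). (b, y)"])
    show "finite ?S" using fin by simp
    have "?E = (\<lambda>(x, a, b, y). (b, y)) ` ?S" by (force simp: image_iff)
    thus "finite ?E" using fin by simp
    show "(\<lambda>(x, a, b, y). (b, y)) ` ?S \<subseteq> ?E" by auto
    fix e assume "e \<in> ?E"
    then obtain a b y where e: "e = (b, y)" "(x, a, b, y) \<in> light_walks"
      using colour_light_subset by blast
    have "{s\<in>?S. (\<lambda>(x, a, b, y). (b, y)) s = e} \<subseteq> (\<lambda>a. (x, a, b, y)) ` (N x \<inter> N b)"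
      using colour_light_subset light_walk_adj(1,5) by (fastforce simp: e)
    hence "card {s\<in>?S. (\<lambda>(x, a, b, y). (b, y)) s = e} \<le> card (N x \<inter> N b)"
      by (rule surj_card_le[rotated]) auto
    moreover have "\<not> heavy x b" using e(2) by (auto simp: light_walks_def)
    ultimately show "card {s\<in>?S. (\<lambda>(x, a, b, y). (b, y)) s = e} \<le> 12 * k"
      by (simp add: heavy_def)
  qed
  also have "\<dots> \<le> 12 * k * ((192 * k * k + 20 * k) * (card V + card V))"
    by (intro mult_left_mono card_last_edges_le assms) auto
  finally show "card ?S \<le> 12 * k * ((192 * k * k + 20 * k) * (card V + card V))" .
qed (rule finite_V)

lemma card_three_walks_le:
  assumes "3 \<le> k"
  shows "card three_walks \<le> 20000 * k ^ 3 * card V ^ 2"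
proof -
  have "card three_walks \<le> card light_walks + (24 * k + 3) * card cherries"
    by (rule card_three_walks_le_light)
  also have "\<dots> \<le> 2 * (12 * k * ((192 * k * k + 20 * k) * (card V + card V)) * card V) +
      (24 * k + 3) * (12 * k * card V * card V)"
    using card_light_walks_le card_colour_light_walks_le[OF assms] card_cherries_le
    by (intro add_mono mult_left_mono) auto
  also have "\<dots> = (9216 * k ^ 3 + 1248 * k ^ 2 + 36 * k) * card V ^ 2"
    by (simp add: algebra_simps power2_eq_square power3_eq_cube)
  also have "\<dots> \<le> (9216 * k ^ 3 + 1248 * k ^ 3 + 36 * k ^ 3) * card V ^ 2"
    using assms by (intro mult_right_mono add_mono mult_left_mono power_increasing self_le_power) auto
  also have "\<dots> \<le> 20000 * k ^ 3 * card V ^ 2" by simp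
  finally show ?thesis .
qed

subsection \<open>Walks of arbitrary length\<close>

definition walks :: "nat \<Rightarrow> 'a list set" where
  "walks m = {vs. length vs = Suc m \<and> set vs \<subseteq> V \<and> successively adj vs}"

lemma finite_walks: "finite (walks m)"
  by (rule finite_subset[OF _ finite_lists_length_eq[OF finite_V, of "Suc m"]]) (auto simp: walks_def)

lemma card_walks_0: "card (walks 0) \<le> card V"
proof -
  have "walks 0 \<subseteq> (\<lambda>v. [v]) ` V"
    by (auto simp: walks_def length_Suc_conv)
  thus ?thesis by (rule surj_card_le[OF finite_V])
qed

text \<open>The two vertices dropped form a walk of length two from the head of the rest.\<close>

lemma card_walks_step: "card (walks (m + 2)) \<le> 12 * k * card V * card (walks m)"
proof (rule card_le_fibres[where f = "drop 2"])
  show "drop 2 ` walks (m + 2) \<subseteq> walks m"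
    by (auto simp: walks_def length_Suc_conv successively_Cons)
  fix w assume "w \<in> walks m"
  then obtain v w' where w: "w = v # w'" by (auto simp: walks_def length_Suc_conv)
  have fin: "finite {(b, y). adj v b \<and> adj b y}"
    by (rule finite_subset[of _ "V \<times> V"]) (auto simp: finite_V dest: adj_V adj_V2)
  have "{s \<in> walks (m + 2). drop 2 s = w} \<subseteq> (\<lambda>(b, y). y # b # w) ` {(b, y). adj v b \<and> adj b y}"
  proof
    fix s assume s: "s \<in> {s \<in> walks (m + 2). drop 2 s = w}"
    then obtain y b where "s = y # b # w"
      by (auto simp: walks_def length_Suc_conv)
    with s show "s \<in> (\<lambda>(b, y). y # b # w) ` {(b, y). adj v b \<and> adj b y}"
      by (auto simp: walks_def w adj_commute)
  qed
  hence "card {s \<in> walks (m + 2). drop 2 s = w} \<le> card {(b, y). adj v b \<and> adj b y}"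
    by (rule surj_card_le[OF fin])
  also have "\<dots> \<le> 12 * k * card V" by (rule card_two_walks_from)
  finally show "card {s \<in> walks (m + 2). drop 2 s = w} \<le> 12 * k * card V" .
qed (rule finite_walks)+

lemma card_walks_add: "card (walks (2 * j + m)) \<le> (12 * k * card V) ^ j * card (walks m)"
proof (induction j)
  case (Suc j)
  have "card (walks (2 * Suc j + m)) \<le> 12 * k * card V * card (walks (2 * j + m))"
    using card_walks_step[of "2 * j + m"] by (simp add: algebra_simps)
  also have "\<dots> \<le> 12 * k * card V * ((12 * k * card V) ^ j * card (walks m))"
    by (intro mult_left_mono Suc.IH) simp
  finally show ?case by (simp only: power_Suc mult_ac)
qed simp

lemma card_walks_3:
  assumes "3 \<le> k"
  shows "card (walks 3) \<le> 20000 * k ^ 3 * card V ^ 2"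
proof -
  have "walks 3 \<subseteq> (\<lambda>(x, a, b, y). [x, a, b, y]) ` three_walks"
    by (auto simp: walks_def three_walks_def length_Suc_conv eval_nat_numeral image_iff)
  hence "card (walks 3) \<le> card three_walks"
    by (rule surj_card_le[OF finite_three_walks])
  thus ?thesis using card_three_walks_le[OF assms] by simp
qed

text \<open>Cauchy-Schwarz on the degrees, with the sum of squares counted by
  \<open>cherries\<close>. This is the base for odd lengths when \<open>k = 2\<close>.\<close>

lemma card_walks_1: "(card (walks 1))\<^sup>2 \<le> 12 * k * card V ^ 3"
proof -
  have "walks 1 \<subseteq> (\<lambda>(a, b). [a, b]) ` (SIGMA a:V. N a)"
    by (auto simp: walks_def length_Suc_conv)
  hence "card (walks 1) \<le> card (SIGMA a:V. N a)"
    by (rule surj_card_le[rotated]) (auto simp: finite_V)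
  hence w: "card (walks 1) \<le> (\<Sum>a\<in>V. card (N a))"
    using finite_V by simp
  have "cherries = (SIGMA a:V. N a \<times> N a)"
    by (auto simp: cherries_def dest: adj_V)
  hence c: "card cherries = (\<Sum>a\<in>V. (card (N a))\<^sup>2)"
    using finite_V by (simp add: card_cartesian_product power2_eq_square)
  have "(\<Sum>a\<in>V. real (card (N a)))\<^sup>2 \<le> real (card V) * (\<Sum>a\<in>V. (real (card (N a)))\<^sup>2)"
    using Cauchy_Schwarz_ineq_sum[of "\<lambda>_. 1" "\<lambda>a. real (card (N a))" V] by simp
  hence "real ((\<Sum>a\<in>V. card (N a))\<^sup>2) \<le> real (card V * card cherries)"
    by (simp add: c)
  hence "(\<Sum>a\<in>V. card (N a))\<^sup>2 \<le> card V * card cherries" by (simp only: of_nat_le_iff)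
  also have "\<dots> \<le> card V * (12 * k * card V * card V)"
    by (intro mult_left_mono card_cherries_le) simp
  finally have "(\<Sum>a\<in>V. card (N a))\<^sup>2 \<le> 12 * k * card V ^ 3"
    by (simp add: power3_eq_cube algebra_simps)
  moreover have "(card (walks 1))\<^sup>2 \<le> (\<Sum>a\<in>V. card (N a))\<^sup>2"
    by (rule power_mono[OF w]) simp
  ultimately show ?thesis by (rule order_trans[rotated])
qed

text \<open>Two-step extension from length 0 or, for odd \<open>l\<close>, from length 3. Starting
  at 3 instead of 1 saves a factor of order \<open>sqrt n\<close>.\<close>

lemma card_walks_le:
  assumes "3 \<le> k" "2 \<le> l"
  shows "card (walks l) \<le> 20000 * k ^ 3 * (12 * k) ^ l * card V ^ (l div 2 + 1)"
proof (cases "even l")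
  case True
  then obtain j where l: "l = 2 * j" by blast
  have "card (walks l) \<le> (12 * k * card V) ^ j * card (walks 0)"
    using card_walks_add[of j 0] by (simp add: l)
  also have "\<dots> \<le> (12 * k * card V) ^ j * card V"
    by (intro mult_left_mono card_walks_0) simp
  also have "\<dots> = 1 * (12 * k) ^ j * card V ^ (l div 2 + 1)"
    by (simp add: l power_mult_distrib algebra_simps)
  also have "\<dots> \<le> 20000 * k ^ 3 * (12 * k) ^ l * card V ^ (l div 2 + 1)"
    using assms by (intro mult_right_mono mult_mono power_increasing) (auto simp: l)
  finally show ?thesis .
next
  case False
  then obtain j' where "l = Suc (2 * j')" by (auto elim: oddE)
  with assms obtain j where l: "l = 2 * j + 3" by (cases j') auto
  have "card (walks l) \<le> (12 * k * card V) ^ j * card (walks 3)"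
    using card_walks_add[of j 3] by (simp add: l)
  also have "\<dots> \<le> (12 * k * card V) ^ j * (20000 * k ^ 3 * card V ^ 2)"
    by (intro mult_left_mono card_walks_3 assms) simp
  also have "\<dots> = 20000 * k ^ 3 * (12 * k) ^ j * card V ^ (l div 2 + 1)"
    by (simp add: l power_mult_distrib power2_eq_square algebra_simps)
  also have "\<dots> \<le> 20000 * k ^ 3 * (12 * k) ^ l * card V ^ (l div 2 + 1)"
    using assms by (intro mult_mono power_increasing order_refl) (auto simp: l)
  finally show ?thesis .
qed

text \<open>Odd lengths start from a single edge, so \<open>k = 2\<close> is covered. An empty
  vertex set is set apart because passing from powers to \<open>powr\<close> takes a positive
  base.\<close>

lemma card_walks_le_powr:
  "real (card (walks l)) \<le> (12 * real k) ^ (l + 1) * real (card V) powr (real l / 2 + 1)"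
proof (cases "card V = 0")
  case True
  hence "V = {}" using finite_V by simp
  hence "walks l = {}" unfolding walks_def by auto
  thus ?thesis by simp
next
  case False
  define n where "n = real (card V)"
  have n: "n > 0" using False by (simp add: n_def)
  have k1: "12 * real k \<ge> 1" using k_ge_2 by simp
  show ?thesis
  proof (cases "even l")
    case True
    then obtain j where l: "l = 2 * j" by blast
    have "card (walks l) \<le> (12 * k * card V) ^ j * card (walks 0)"
      using card_walks_add[of j 0] by (simp add: l)
    also have "\<dots> \<le> (12 * k * card V) ^ j * card V"
      by (intro mult_left_mono card_walks_0) simp
    finally have "real (card (walks l)) \<le> real ((12 * k * card V) ^ j * card V)"
      by (simp only: of_nat_le_iff)
    also have "\<dots> = (12 * real k) ^ j * n ^ (j + 1)"
      by (simp add: n_def power_mult_distrib algebra_simps)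
    also have "n ^ (j + 1) = n powr (real l / 2 + 1)"
      using n by (simp add: l powr_realpow[symmetric] powr_add)
    also have "(12 * real k) ^ j * n powr (real l / 2 + 1) \<le> (12 * real k) ^ (l + 1) * n powr (real l / 2 + 1)"
      using k1 by (intro mult_right_mono power_increasing) (auto simp: l)
    finally show ?thesis by (simp add: n_def)
  next
    case False
    then obtain j where l: "l = 2 * j + 1" by (auto elim: oddE)
    have "(real (card (walks 1)))\<^sup>2 = real ((card (walks 1))\<^sup>2)" by simp
    also have "\<dots> \<le> real (12 * k * card V ^ 3)"
      using card_walks_1 by (simp only: of_nat_le_iff)
    also have "\<dots> = 12 * real k * n ^ 3" by (simp add: n_def)
    \<comment> \<open>The factor is squared so that the right-hand side becomes a perfect
      square.\<close>
    also have "\<dots> \<le> (12 * real k)\<^sup>2 * n ^ 3"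
      using n by (intro mult_right_mono self_le_power k1) auto
    also have "n ^ 3 = (n powr (3 / 2))\<^sup>2"
      using n powr_realpow[of n 3] by (simp add: power2_eq_square flip: powr_add)
    finally have "(real (card (walks 1)))\<^sup>2 \<le> (12 * real k * n powr (3 / 2))\<^sup>2"
      by (simp add: power_mult_distrib)
    hence w1: "real (card (walks 1)) \<le> 12 * real k * n powr (3 / 2)"
      by (rule power2_le_imp_le) simp
    have "card (walks l) \<le> (12 * k * card V) ^ j * card (walks 1)"
      using card_walks_add[of j 1] by (simp add: l)
    hence "real (card (walks l)) \<le> real ((12 * k * card V) ^ j * card (walks 1))"
      by (simp only: of_nat_le_iff)
    also have "\<dots> = (12 * real k) ^ j * n ^ j * real (card (walks 1))"
      by (simp add: n_def power_mult_distrib)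
    also have "\<dots> \<le> (12 * real k) ^ j * n ^ j * (12 * real k * n powr (3 / 2))"
      using n by (intro mult_left_mono w1) auto
    also have "\<dots> = (12 * real k) ^ (j + 1) * (n powr (real j) * n powr (3 / 2))"
      using n by (simp add: powr_realpow)
    also have "n powr (real j) * n powr (3 / 2) = n powr (real l / 2 + 1)"
      using n by (simp add: l add_divide_distrib add.commute flip: powr_add)
    also have "(12 * real k) ^ (j + 1) * n powr (real l / 2 + 1) \<le> (12 * real k) ^ (l + 1) * n powr (real l / 2 + 1)"
      using k1 by (intro mult_right_mono power_increasing) (auto simp: l)
    finally show ?thesis by (simp add: n_def)
  qed
qed

end

section \<open>Copies as images of injective maps\<close>

lemma graph_iso_image:
  assumes "inj_on g (verts H)" "\<And>e. e \<in> edges H \<Longrightarrow> e \<subseteq> verts H"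
  shows "graph_iso (g ` verts H, (`) g ` edges H) H"
  unfolding graph_iso_def
proof (intro exI conjI ballI)
  let ?f = "the_inv_into (verts H) g"
  show "bij_betw ?f (verts (g ` verts H, (`) g ` edges H)) (verts H)"
    using assms(1) by (simp add: bij_betw_the_inv_into inj_on_imp_bij_betw)
  fix u v assume "u \<in> verts (g ` verts H, (`) g ` edges H)" "v \<in> verts (g ` verts H, (`) g ` edges H)"
  then obtain a b where ab: "a \<in> verts H" "b \<in> verts H" "u = g a" "v = g b" by auto
  have "{u, v} \<in> (`) g ` edges H \<longleftrightarrow> {a, b} \<in> edges H"
  proof
    assume "{u, v} \<in> (`) g ` edges H"
    then obtain e where e: "e \<in> edges H" "g ` {a, b} = g ` e" by (auto simp: ab)
    hence "{a, b} = e"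
      using assms ab by (subst (asm) inj_on_image_eq_iff[of g "verts H"]) auto
    thus "{a, b} \<in> edges H" using e by simp
  qed (auto simp: ab image_iff intro!: bexI[of _ "{a, b}"])
  thus "{u, v} \<in> edges (g ` verts H, (`) g ` edges H) \<longleftrightarrow> {?f u, ?f v} \<in> edges H"
    using assms(1) ab by (simp add: the_inv_into_f_f)
qed

text \<open>The map \<open>g\<close> inverts the isomorphism; several \<open>g\<close> may give one
  copy. Edges are doubletons, so the condition on pairs in \<open>graph_iso\<close> determines the
  whole edge set.\<close>

lemma in_copies_iff:
  assumes "simple_graph H"
  shows "S \<in> copies H G \<longleftrightarrow> (\<exists>g. inj_on g (verts H) \<and> S = (g ` verts H, (`) g ` edges H) \<and>
    g ` verts H \<subseteq> verts G \<and> (\<forall>e\<in>edges H. g ` e \<in> edges G))"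
proof
  have H: "e \<subseteq> verts H" "card e = 2" if "e \<in> edges H" for e
    using assms that by (auto simp: simple_graph_def)
  have two: "\<exists>a b. e = {a, b} \<and> a \<noteq> b" if "card e = 2" for e :: "'x set"
    using that by (auto simp: card_2_iff)
  {
    assume "S \<in> copies H G"
    then obtain f where S: "simple_graph S" "verts S \<subseteq> verts G" "edges S \<subseteq> edges G"
      and bij: "bij_betw f (verts S) (verts H)"
      and f: "\<And>u v. u \<in> verts S \<Longrightarrow> v \<in> verts S \<Longrightarrow> {u, v} \<in> edges S \<longleftrightarrow> {f u, f v} \<in> edges H"
      unfolding copies_def subgraph_def graph_iso_def by blast
    let ?g = "the_inv_into (verts S) f"
    have g: "bij_betw ?g (verts H) (verts S)" by (rule bij_betw_the_inv_into[OF bij])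
    have fg: "f (?g a) = a" if "a \<in> verts H" for a
      using that bij by (simp add: f_the_inv_into_f_bij_betw)
    have gV: "?g a \<in> verts S" if "a \<in> verts H" for a
      using that g by (auto simp: bij_betw_def)
    have "?g ` e \<in> edges S" if e: "e \<in> edges H" for e
    proof -
      obtain a b where ab: "e = {a, b}" using H(2)[OF e] two by blast
      hence "a \<in> verts H" "b \<in> verts H" using H(1)[OF e] by auto
      thus ?thesis using f[of "?g a" "?g b"] gV fg e ab by auto
    qed
    moreover have "e \<in> (`) ?g ` edges H" if e: "e \<in> edges S" for e
    proof -
      have "card e = 2" "e \<subseteq> verts S" using S(1) e by (auto simp: simple_graph_def)
      then obtain u v where uv: "e = {u, v}" "u \<in> verts S" "v \<in> verts S"
        by (auto simp: card_2_iff)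
      hence "{f u, f v} \<in> edges H" using f e by simp
      moreover have "?g ` {f u, f v} = e"
        using uv bij by (simp add: bij_betw_def the_inv_into_f_f)
      ultimately show ?thesis by blast
    qed
    ultimately have "edges S = (`) ?g ` edges H" by blast
    thus "\<exists>g. inj_on g (verts H) \<and> S = (g ` verts H, (`) g ` edges H) \<and>
        g ` verts H \<subseteq> verts G \<and> (\<forall>e\<in>edges H. g ` e \<in> edges G)"
      using g S by (intro exI[of _ ?g]) (auto simp: bij_betw_def prod_eq_iff)
  }
  assume "\<exists>g. inj_on g (verts H) \<and> S = (g ` verts H, (`) g ` edges H) \<and>
    g ` verts H \<subseteq> verts G \<and> (\<forall>e\<in>edges H. g ` e \<in> edges G)"
  then obtain g where g: "inj_on g (verts H)" "S = (g ` verts H, (`) g ` edges H)"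
    "g ` verts H \<subseteq> verts G" "\<forall>e\<in>edges H. g ` e \<in> edges G" by blast
  have "card (g ` e) = 2" if "e \<in> edges H" for e
    using H[OF that] g(1) by (metis card_image inj_on_subset)
  moreover have "g ` e \<subseteq> g ` verts H" if "e \<in> edges H" for e
    using H(1)[OF that] by blast
  ultimately have "simple_graph S"
    using g(2) assms by (auto simp: simple_graph_def)
  thus "S \<in> copies H G"
    using g graph_iso_image[OF g(1) H(1)] by (auto simp: copies_def subgraph_def)
qed

lemma simple_path_graph: "simple_graph (path_graph l)"
  by (auto simp: simple_graph_def path_graph_def)

lemma simple_cycle_graph:
  assumes "2 \<le> m"
  shows "simple_graph (cycle_graph m)"
proof -
  have "i \<noteq> Suc i mod m" if "i < m" for i
    using that assms by (cases "Suc i = m") auto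
  thus ?thesis
    using assms by (auto simp: simple_graph_def cycle_graph_def)
qed

section \<open>Copies of paths and rainbow cycles\<close>

definition walk_graph :: "'a list \<Rightarrow> 'a graph" where
  "walk_graph vs = (set vs, (\<lambda>i. {vs ! i, vs ! Suc i}) ` {..<length vs - 1})"

lemma path_graph_image:
  "verts (path_graph l) = {..<Suc l}" "edges (path_graph l) = (\<lambda>i. {i, Suc i}) ` {..<l}"
  by (auto simp: path_graph_def)

lemma cycle_graph_image:
  "verts (cycle_graph m) = {..<m}" "edges (cycle_graph m) = (\<lambda>i. {i, Suc i mod m}) ` {..<m}"
  by (auto simp: cycle_graph_def)

text \<open>The images of \<open>0\<close>, ..., \<open>l\<close> in order trace the copy, so bounds
  on walks pass to copies.\<close>

lemma path_copies_subset:
  "copies (path_graph l) G \<subseteq> walk_graph `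
     {vs. length vs = Suc l \<and> set vs \<subseteq> verts G \<and> successively (\<lambda>u v. {u, v} \<in> edges G) vs}"
proof
  fix S assume "S \<in> copies (path_graph l) G"
  then obtain g where g: "S = (g ` {..<Suc l}, (`) g ` (\<lambda>i. {i, Suc i}) ` {..<l})"
    "g ` {..<Suc l} \<subseteq> verts G" "\<And>i. i < l \<Longrightarrow> {g i, g (Suc i)} \<in> edges G"
    unfolding in_copies_iff[OF simple_path_graph] path_graph_image by auto
  let ?vs = "map g [0..<Suc l]"
  have nth: "?vs ! i = g i" if "i < Suc l" for i
    using that by (simp del: upt_Suc)
  have "(\<lambda>i. {?vs ! i, ?vs ! Suc i}) ` {..<l} = (\<lambda>i. {g i, g (Suc i)}) ` {..<l}"
    by (intro image_cong refl) (simp add: nth del: upt_Suc)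
  hence "walk_graph ?vs = S"
    by (simp add: walk_graph_def g(1) image_image atLeast0LessThan del: upt_Suc)
  moreover have "successively (\<lambda>u v. {u, v} \<in> edges G) ?vs"
    using g(3) by (auto simp: successively_conv_nth nth simp del: upt_Suc)
  ultimately show "S \<in> walk_graph `
      {vs. length vs = Suc l \<and> set vs \<subseteq> verts G \<and> successively (\<lambda>u v. {u, v} \<in> edges G) vs}"
    using g(2) by (intro image_eqI[of _ _ ?vs]) (auto simp: atLeast0LessThan simp del: upt_Suc)
qed

lemma finite_path_copies:
  assumes "finite (verts G)"
  shows "finite (copies (path_graph l) G)"
    and "card (copies (path_graph l) G) \<le> card (verts G) ^ Suc l"
proof -
  let ?W = "{vs. set vs \<subseteq> verts G \<and> length vs = Suc l}"
  have *: "copies (path_graph l) G \<subseteq> walk_graph ` ?W"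
    using path_copies_subset[of l G] by blast
  have fin: "finite ?W" by (rule finite_lists_length_eq[OF assms])
  show "finite (copies (path_graph l) G)"
    using fin * finite_surj by blast
  have "card (copies (path_graph l) G) \<le> card ?W"
    by (rule surj_card_le[OF fin *])
  thus "card (copies (path_graph l) G) \<le> card (verts G) ^ Suc l"
    by (simp only: card_lists_length_eq[OF assms])
qed

definition rainbow_free :: "nat \<Rightarrow> 'a graph \<Rightarrow> ('a set \<Rightarrow> 'c) \<Rightarrow> bool" where
  "rainbow_free m G c \<longleftrightarrow> simple_graph G \<and> proper_edge_colouring G c \<and>
     \<not> (\<exists>S \<in> copies (cycle_graph m) G. rainbow c S)"

text \<open>Makes \<open>Max\<close> usable: copies come from lists of \<open>l + 1\<close>
  vertices, which bounds the counts, and the edgeless graph is admissible.\<close>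

lemma ex_rainbow_path_bounds:
  fixes l m n :: nat
  assumes "2 \<le> m"
  defines "M \<equiv> {card (copies (path_graph l) G) | (G :: nat graph) (c :: nat set \<Rightarrow> nat).
     simple_graph G \<and> card (verts G) = n \<and> proper_edge_colouring G c \<and>
     \<not> (\<exists>S \<in> copies (cycle_graph m) G. rainbow c S)}"
  shows "finite M" "M \<noteq> {}" "ex_rainbow n (path_graph l) (cycle_graph m) = Max M"
proof -
  have "M \<subseteq> {..n ^ Suc l}"
    using finite_path_copies(2) by (fastforce simp: M_def simple_graph_def)
  thus "finite M" using finite_subset by blast
  let ?G = "({0..<n}, {}) :: nat graph"
  have "S \<notin> copies (cycle_graph m) ?G" for S
    using simple_cycle_graph[OF assms(1)] assms(1)
    by (auto simp: in_copies_iff cycle_graph_def intro!: exI[of _ 0])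
  hence "card (copies (path_graph l) ?G) \<in> M"
    unfolding M_def by (intro CollectI exI[of _ ?G] exI[of _ "\<lambda>_. 0"])
      (auto simp: simple_graph_def proper_edge_colouring_def)
  thus "M \<noteq> {}" by blast
qed (simp add: M_def ex_rainbow_def)

lemma ex_rainbow_path_le:
  fixes l m n :: nat and B :: real
  assumes "2 \<le> m"
    and "\<And>(G :: nat graph) (c :: nat set \<Rightarrow> nat). rainbow_free m G c \<Longrightarrow> card (verts G) = n \<Longrightarrow>
           real (card (copies (path_graph l) G)) \<le> B"
  shows "real (ex_rainbow n (path_graph l) (cycle_graph m)) \<le> B"
proof -
  note X = ex_rainbow_path_bounds[OF assms(1), where l = l and n = n]
  show ?thesis
    using Max_in[OF X(1,2)] unfolding X(3) by (auto intro!: assms(2) simp: rainbow_free_def)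
qed

lemma ex_rainbow_path_ge:
  fixes G :: "nat graph" and c :: "nat set \<Rightarrow> nat"
  assumes "2 \<le> m" "rainbow_free m G c" "card (verts G) = n"
  shows "card (copies (path_graph l) G) \<le> ex_rainbow n (path_graph l) (cycle_graph m)"
proof -
  note X = ex_rainbow_path_bounds[OF assms(1), where l = l and n = n]
  show ?thesis
    unfolding X(3) using assms(2,3)
    by (intro Max_ge[OF X(1)] CollectI exI[of _ G] exI[of _ c]) (simp add: rainbow_free_def)
qed

lemma path_cols_nth: "Suc i < length p \<Longrightarrow> path_cols col p ! i = col (p ! i) (p ! Suc i)"
proof (induction col p arbitrary: i rule: path_cols.induct)
  case (1 col u v p)
  thus ?case by (cases i) auto
qed auto

text \<open>A rainbow path whose closing edge had a new colour would yield a rainbow copy of the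
  cycle through the map \<open>(!) p\<close>.\<close>

lemma rainbow_free_imp_locale:
  assumes G: "rainbow_free (2 * k) G c" and k: "2 \<le> k"
  shows "rainbow_cycle_free (verts G) (\<lambda>u v. {u, v} \<in> edges G) (\<lambda>u v. c {u, v}) k"
proof
  have sg: "e \<subseteq> verts G" "card e = 2" if "e \<in> edges G" for e
    using G that by (auto simp: rainbow_free_def simple_graph_def)
  have pr: "c e \<noteq> c e'" if "e \<in> edges G" "e' \<in> edges G" "e \<noteq> e'" "e \<inter> e' \<noteq> {}" for e e'
    using G that by (auto simp: rainbow_free_def proper_edge_colouring_def)
  show "finite (verts G)" using G by (auto simp: rainbow_free_def simple_graph_def)
  show "2 \<le> k" by (rule k)
  show "{u, v} \<in> edges G \<Longrightarrow> u \<in> verts G" for u v using sg(1) by blast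
  show "{u, v} \<in> edges G \<Longrightarrow> {v, u} \<in> edges G" for u v by (simp add: insert_commute)
  show "{u, u} \<notin> edges G" for u using sg(2)[of "{u, u}"] by auto
  show "c {u, v} = c {v, u}" for u v by (simp add: insert_commute)
  show "v = w" if "{u, v} \<in> edges G" "{u, w} \<in> edges G" "c {u, v} = c {u, w}" for u v w
    using pr[OF that(1,2)] that(3) by (auto simp: doubleton_eq_iff)
  fix p
  let ?adj = "\<lambda>u v. {u, v} \<in> edges G" and ?col = "\<lambda>u v. c {u, v}" and ?m = "2 * k"
  assume p: "rainbow_path ?adj ?col p" "length p = 2 * k" and closing: "?adj (hd p) (last p)"
  let ?e = "\<lambda>i. {p ! i, p ! (Suc i mod ?m)}"
  \<comment> \<open>With the closing colour appended, entry \<open>i\<close> is the colour of the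
    cycle edge \<open>?e i\<close>, including the wrap-around edge \<open>2 * k - 1\<close>.\<close>
  let ?cs = "path_cols ?col p @ [?col (hd p) (last p)]"
  have p0: "p \<noteq> []" using p(1) by (simp add: rainbow_path_def)
  have split: "i < ?m - 1 \<or> i = ?m - 1" if "i < ?m" for i using that by linarith
  have wrap: "Suc (?m - 1) mod ?m = 0" using k by simp
  have ends: "hd p = p ! 0" "last p = p ! (?m - 1)"
    using p0 p(2) by (simp_all add: hd_conv_nth last_conv_nth)
  have cs: "?cs ! i = c (?e i)" if "i < ?m" for i
    using split[OF that]
  proof
    assume "i < ?m - 1"
    thus ?thesis
      using p(2) path_cols_nth[of i p ?col] by (simp add: nth_append length_path_cols)
  next
    assume i: "i = ?m - 1"
    have "?cs ! i = ?col (hd p) (last p)"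
      using p(2) by (simp add: nth_append length_path_cols i)
    thus ?thesis by (simp only: i wrap ends insert_commute)
  qed
  have edge: "?e i \<in> edges G" if "i < ?m" for i
    using split[OF that]
  proof
    assume "i < ?m - 1"
    thus ?thesis
      using p by (simp add: rainbow_path_def successively_conv_nth)
  next
    assume i: "i = ?m - 1"
    show ?thesis using closing by (simp only: i wrap ends insert_commute)
  qed
  show "?col (hd p) (last p) \<in> set (path_cols ?col p)"
  proof (rule ccontr)
    assume "\<not> ?thesis"
    hence dist: "distinct ?cs" using p(1) by (simp add: rainbow_path_def)
    let ?H = "cycle_graph ?m"
    have H: "simple_graph ?H" using k by (intro simple_cycle_graph) simp
    define S where "S = ((!) p ` verts ?H, (`) ((!) p) ` edges ?H)"
    have inj: "inj_on ((!) p) (verts ?H)"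
      using p by (auto simp: rainbow_path_def cycle_graph_def inj_on_def nth_eq_iff_index_eq)
    have "S \<in> copies ?H G"
      unfolding in_copies_iff[OF H]
    proof (intro exI[of _ "(!) p"] conjI inj ballI)
      show "S = ((!) p ` verts ?H, (`) ((!) p) ` edges ?H)" by (rule S_def)
      show "(!) p ` verts ?H \<subseteq> verts G"
        using edge sg(1) by (fastforce simp: cycle_graph_def)
      fix e assume "e \<in> edges ?H"
      then obtain i where "i < ?m" "e = {i, Suc i mod ?m}" by (auto simp: cycle_graph_def)
      thus "(!) p ` e \<in> edges G" using edge[of i] by simp
    qed
    moreover have "rainbow c S"
      unfolding rainbow_def
    proof (rule inj_onI)
      fix e e' assume "e \<in> edges S" "e' \<in> edges S" and ce: "c e = c e'"
      then obtain i j where ij: "i < ?m" "e = ?e i" "j < ?m" "e' = ?e j"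
        by (auto simp: S_def cycle_graph_def)
      hence "?cs ! i = ?cs ! j" using ce cs by simp
      hence "i = j"
        using dist ij p(2) by (subst (asm) nth_eq_iff_index_eq) (auto simp: length_path_cols)
      thus "e = e'" using ij by simp
    qed
    ultimately show False using G by (auto simp: rainbow_free_def)
  qed
qed

lemma card_path_copies_le_walks:
  assumes "rainbow_free (2 * k) G c" "2 \<le> k"
  shows "card (copies (path_graph l) G)
    \<le> card (rainbow_cycle_free.walks (verts G) (\<lambda>u v. {u, v} \<in> edges G) l)"
proof -
  interpret rainbow_cycle_free "verts G" "\<lambda>u v. {u, v} \<in> edges G" "\<lambda>u v. c {u, v}" k
    by (rule rainbow_free_imp_locale[OF assms])
  show ?thesis
    using path_copies_subset[of l G] unfolding walks_def[symmetric] by (rule surj_card_le[OF finite_walks])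
qed

lemma ex_rainbow_path_upper:
  assumes "3 \<le> k" "2 \<le> l"
  shows "real (ex_rainbow n (path_graph l) (cycle_graph (2 * k)))
    \<le> real (20000 * k ^ 3 * (12 * k) ^ l) * real n ^ (l div 2 + 1)"
proof -
  have "real (ex_rainbow n (path_graph l) (cycle_graph (2 * k)))
      \<le> real (20000 * k ^ 3 * (12 * k) ^ l * n ^ (l div 2 + 1))"
  proof (rule ex_rainbow_path_le)
    fix G :: "nat graph" and c :: "nat set \<Rightarrow> nat"
    assume G: "rainbow_free (2 * k) G c" "card (verts G) = n"
    have k: "2 \<le> k" using assms by simp
    interpret rainbow_cycle_free "verts G" "\<lambda>u v. {u, v} \<in> edges G" "\<lambda>u v. c {u, v}" k
      by (rule rainbow_free_imp_locale[OF G(1) k])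
    show "real (card (copies (path_graph l) G)) \<le> real (20000 * k ^ 3 * (12 * k) ^ l * n ^ (l div 2 + 1))"
      using card_path_copies_le_walks[OF G(1) k, of l] card_walks_le[OF assms] G(2)
      by (simp only: of_nat_le_iff)
  qed (use assms in simp)
  thus ?thesis by simp
qed

lemma ex_rainbow_path_upper_powr:
  assumes "2 \<le> k"
  shows "real (ex_rainbow n (path_graph l) (cycle_graph (2 * k)))
    \<le> (12 * real k) ^ (l + 1) * real n powr (real l / 2 + 1)"
proof (rule ex_rainbow_path_le)
  fix G :: "nat graph" and c :: "nat set \<Rightarrow> nat"
  assume G: "rainbow_free (2 * k) G c" "card (verts G) = n"
  interpret rainbow_cycle_free "verts G" "\<lambda>u v. {u, v} \<in> edges G" "\<lambda>u v. c {u, v}" k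
    by (rule rainbow_free_imp_locale[OF G(1) assms])
  show "real (card (copies (path_graph l) G)) \<le> (12 * real k) ^ (l + 1) * real n powr (real l / 2 + 1)"
    using card_path_copies_le_walks[OF G(1) assms, of l] card_walks_le_powr[of l] G(2) by simp
qed (use assms in simp)

section \<open>Lower bounds\<close>

text \<open>Giving all edges different colours is proper, and there is no cycle to be
  rainbow.\<close>

lemma rainbow_free_if_no_copies:
  assumes "simple_graph G" "copies (cycle_graph m) G = {}"
  shows "\<exists>c :: 'a set \<Rightarrow> nat. rainbow_free m G c"
proof -
  have "finite (edges G)"
    using assms(1) finite_subset[of "edges G" "Pow (verts G)"] by (auto simp: simple_graph_def)
  then obtain c :: "'a set \<Rightarrow> nat" where "inj_on c (edges G)"
    using finite_imp_inj_to_nat_seg by blast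
  hence "proper_edge_colouring G c"
    by (auto simp: proper_edge_colouring_def inj_on_def)
  thus ?thesis using assms by (auto simp: rainbow_free_def)
qed

lemma ex_rainbow_path_ge_if_no_copies:
  fixes G :: "nat graph"
  assumes "simple_graph G" "copies (cycle_graph m) G = {}" "2 \<le> m" "card (verts G) = n"
  shows "card (copies (path_graph l) G) \<le> ex_rainbow n (path_graph l) (cycle_graph m)"
  using rainbow_free_if_no_copies[OF assms(1,2)] ex_rainbow_path_ge[OF assms(3) _ assms(4)] by blast

text \<open>The blow-up of the even vertices of a path: vertex \<open>u\<close> belongs to the class \<open>u mod (l + 1)\<close>,
  and an odd class is represented by its single member below \<open>l + 1\<close>.\<close>

definition hub_edge :: "nat \<Rightarrow> nat \<Rightarrow> nat \<Rightarrow> bool" where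
  "hub_edge l u v \<longleftrightarrow> even (u mod Suc l) \<and> odd v \<and> v < Suc l \<and>
     (u mod Suc l = Suc v \<or> v = Suc (u mod Suc l))"

definition path_blowup :: "nat \<Rightarrow> nat \<Rightarrow> nat graph" where
  "path_blowup l n = ({..<n}, {{u, v} | u v. u < n \<and> v < n \<and> hub_edge l u v})"

text \<open>Bipartiteness: \<open>hub_edge\<close> runs from an even class to an odd hub, and no
  vertex is both.\<close>

lemma hub_edge_asym: "hub_edge l u v \<Longrightarrow> \<not> hub_edge l v w"
  by (auto simp: hub_edge_def)

lemma in_path_blowup_iff:
  "{u, v} \<in> edges (path_blowup l n) \<longleftrightarrow> u < n \<and> v < n \<and> (hub_edge l u v \<or> hub_edge l v u)"
  by (auto simp: path_blowup_def doubleton_eq_iff)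

lemma simple_path_blowup: "simple_graph (path_blowup l n)"
  using hub_edge_asym by (fastforce simp: simple_graph_def path_blowup_def card_insert_if)

text \<open>All blocks of the blow-up but single edges are complete bipartite with one side of size two. On a cycle of
  length at least six the hub with the largest index would therefore have the same hub at distance
  two on both sides.\<close>

lemma no_long_cycle_in_path_blowup:
  assumes "6 \<le> m"
  shows "copies (cycle_graph m) (path_blowup l n) = {}"
proof (rule equals0I)
  fix S assume "S \<in> copies (cycle_graph m) (path_blowup l n)"
  moreover have "2 \<le> m" using assms by simp
  ultimately obtain g where inj: "inj_on g {..<m}"
    and edge: "\<And>i. i < m \<Longrightarrow> {g i, g (Suc i mod m)} \<in> edges (path_blowup l n)"
    by (auto simp: in_copies_iff[OF simple_cycle_graph] cycle_graph_image)
  \<comment> \<open>The cycle is extended periodically so that indices need not be reduced.\<close>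
  define h where "h i = g (i mod m)" for i
  have m0: "m > 0" using assms by simp
  have adj: "hub_edge l (h i) (h (Suc i)) \<or> hub_edge l (h (Suc i)) (h i)" for i
    using edge[of "i mod m"] m0 by (simp add: h_def in_path_blowup_iff mod_Suc_eq)
  define I where "I = {i. i < m \<and> (\<exists>u. hub_edge l u (h i))}"
  have I: "finite I" "I \<noteq> {}"
  proof -
    have "0 \<in> I \<or> 1 \<in> I"
      using adj[of 0] assms by (auto simp: I_def)
    thus "I \<noteq> {}" by blast
  qed (simp add: I_def)
  obtain i where i: "i \<in> I" and max: "\<And>j. j \<in> I \<Longrightarrow> h j \<le> h i"
  proof -
    have "Max (h ` I) \<in> h ` I" using I by simp
    then obtain i where "i \<in> I" "h i = Max (h ` I)" by auto
    thus ?thesis using that I(1) by auto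
  qed
  have hub_le: "h j \<le> h i" if "hub_edge l u (h j)" for j u
  proof -
    have "j mod m \<in> I" using that m0 by (auto simp: I_def h_def)
    thus ?thesis using max[of "j mod m"] by (simp add: h_def)
  qed
  obtain u where u: "hub_edge l u (h i)" using i by (auto simp: I_def)
  have im: "i < m" using i by (simp add: I_def)
  \<comment> \<open>A vertex of class \<open>c\<close> is adjacent to the hubs \<open>c - 1\<close>
    and \<open>c + 1\<close> only. If the largest hub is one of two distinct hubs there, it is
    \<open>c + 1\<close> and the other is \<open>c - 1\<close>.\<close>
  have key: "h i = h b + 2"
    if "hub_edge l (h a) (h i) \<or> hub_edge l (h i) (h a)"
      "hub_edge l (h a) (h b) \<or> hub_edge l (h b) (h a)" "h b \<noteq> h i" for a b
  proof -
    have 1: "hub_edge l (h a) (h i)" using that(1) hub_edge_asym[OF u] by blast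
    have 2: "hub_edge l (h a) (h b)"
      using that(2) 1 hub_edge_asym[of l "h b" "h a"] by blast
    show ?thesis using 1 2 hub_le[OF 2] that(3) by (auto simp: hub_edge_def)
  qed
  have neq: "h (i + d) \<noteq> h (i + e)" if "d < e" "e < d + m" for d e
  proof
    assume "h (i + d) = h (i + e)"
    hence "(i + d) mod m = (i + e) mod m"
      using inj m0 by (simp add: h_def inj_on_def)
    hence "m dvd (i + e) - (i + d)" using that by (metis add_le_cancel_left less_imp_le mod_eq_dvd_iff_nat)
    thus False using that by (auto dest: dvd_imp_le)
  qed
  have per: "h (i + m) = h i" by (simp add: h_def)
  have "h i = h (i + 2) + 2"
    using adj[of i] adj[of "Suc i"] neq[of 0 2] assms by (intro key[of "i + 1"]) auto
  \<comment> \<open>Modulo \<open>m\<close>, a shift by \<open>m - 2\<close> goes two steps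
    back.\<close>
  moreover have "h i = h (i + (m - 2)) + 2"
  proof (rule key[of "Suc (i + (m - 2))"])
    have "Suc (Suc (i + (m - 2))) = i + m" using assms by simp
    with adj[of "Suc (i + (m - 2))"] per
    show "hub_edge l (h (Suc (i + (m - 2)))) (h i) \<or> hub_edge l (h i) (h (Suc (i + (m - 2))))"
      by (metis (no_types))
    show "hub_edge l (h (Suc (i + (m - 2)))) (h (i + (m - 2))) \<or>
        hub_edge l (h (i + (m - 2))) (h (Suc (i + (m - 2))))"
      using adj[of "i + (m - 2)"] by blast
    show "h (i + (m - 2)) \<noteq> h i" using neq[of 0 "m - 2"] assms by auto
  qed
  \<comment> \<open>Two steps forward and two steps back are different positions because
    \<open>m > 4\<close>, yet both carry the hub \<open>h i - 2\<close>.\<close>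
  moreover have "2 < m - 2" "m - 2 < 2 + m" using assms by linarith+
  hence "h (i + 2) \<noteq> h (i + (m - 2))" by (rule neq)
  ultimately show False by simp
qed

lemma card_even_atMost: "card {i. i < Suc l \<and> even i} = l div 2 + 1"
proof -
  have "{i. i < Suc l \<and> even i} = (*) 2 ` {..l div 2}" by (auto elim!: evenE)
  thus ?thesis by (simp add: card_image inj_on_def)
qed

text \<open>Each of the \<open>l div 2 + 1\<close> even classes offers at least
  \<open>n div Suc l\<close> vertices, and any selection \<phi> together with the odd hubs forms a
  path.\<close>

lemma card_path_copies_path_blowup:
  "(n div Suc l) ^ (l div 2 + 1) \<le> card (copies (path_graph l) (path_blowup l n))"
proof -
  let ?E = "{i. i < Suc l \<and> even i}" and ?D = "n div Suc l"
  let ?F = "?E \<rightarrow>\<^sub>E {..<?D}"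
  define g where "g \<phi> i = (if even i then i + Suc l * \<phi> i else i)" for \<phi> :: "nat \<Rightarrow> nat" and i
  define S where "S \<phi> = (g \<phi> ` {..<Suc l}, (`) (g \<phi>) ` (\<lambda>i. {i, Suc i}) ` {..<l})" for \<phi>
  have gmod: "g \<phi> i mod Suc l = i" if "i < Suc l" for \<phi> i
    using that by (simp add: g_def del: mult_Suc)
  have sub: "S ` ?F \<subseteq> copies (path_graph l) (path_blowup l n)"
  proof (rule image_subsetI)
    fix \<phi> assume \<phi>: "\<phi> \<in> ?F"
    \<comment> \<open>Position 0 is even, so the existence of \<phi> forces \<open>?D > 0\<close>,
      and all hubs lie below \<open>n\<close>.\<close>
    hence "\<phi> 0 < ?D" by auto
    hence Ln: "Suc l \<le> n" by (metis div_less not_less not_less0)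
    have lt: "g \<phi> i < n" if "i < Suc l" for i
    proof (cases "even i")
      case True
      hence "Suc (\<phi> i) \<le> ?D" using \<phi> that by (auto simp: Suc_le_eq)
      hence "Suc l * Suc (\<phi> i) \<le> Suc l * ?D" by (rule mult_le_mono2)
      also have "\<dots> \<le> n" by (rule times_div_less_eq_dividend)
      finally show ?thesis using True that by (simp add: g_def)
    qed (use that Ln in \<open>simp add: g_def\<close>)
    have edge: "hub_edge l (g \<phi> i) (g \<phi> (Suc i)) \<or> hub_edge l (g \<phi> (Suc i)) (g \<phi> i)" if "i < l" for i
      using that gmod[of i \<phi>] gmod[of "Suc i" \<phi>] unfolding hub_edge_def by (cases "even i") (auto simp: g_def)
    show "S \<phi> \<in> copies (path_graph l) (path_blowup l n)"
      unfolding in_copies_iff[OF simple_path_graph] path_graph_image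
    proof (intro exI[of _ "g \<phi>"] conjI ballI)
      show "inj_on (g \<phi>) {..<Suc l}" by (metis gmod inj_onI lessThan_iff)
      show "S \<phi> = (g \<phi> ` {..<Suc l}, (`) (g \<phi>) ` (\<lambda>i. {i, Suc i}) ` {..<l})" by (rule S_def)
      show "g \<phi> ` {..<Suc l} \<subseteq> verts (path_blowup l n)"
        using lt by (auto simp: path_blowup_def)
      fix e assume "e \<in> (\<lambda>i. {i, Suc i}) ` {..<l}"
      then obtain i where i: "i < l" "e = {i, Suc i}" by auto
      thus "g \<phi> ` e \<in> edges (path_blowup l n)"
        using edge[of i] lt[of i] lt[of "Suc i"] by (simp add: in_path_blowup_iff)
    qed
  qed
  have "inj_on S ?F"
  proof (rule inj_onI)
    fix \<phi> \<psi> assume \<phi>: "\<phi> \<in> ?F" and \<psi>: "\<psi> \<in> ?F" and eq: "S \<phi> = S \<psi>"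
    have "\<phi> i = \<psi> i" if i: "i \<in> ?E" for i
    proof -
      \<comment> \<open>The copy meets each class once, so its vertex set alone recovers
        \<phi>.\<close>
      have "g \<phi> i \<in> g \<psi> ` {..<Suc l}" using eq i by (auto simp: S_def)
      then obtain i' where i': "i' < Suc l" "g \<phi> i = g \<psi> i'" by auto
      hence "i' = i" using gmod[of i \<phi>] gmod[of i' \<psi>] i by simp
      thus ?thesis using i' i by (simp add: g_def del: mult_Suc)
    qed
    thus "\<phi> = \<psi>" by (rule PiE_ext[OF \<phi> \<psi>])
  qed
  hence "card ?F \<le> card (copies (path_graph l) (path_blowup l n))"
    using finite_path_copies(1)[of "path_blowup l n"]
    by (intro card_inj_on_le[OF _ sub]) (auto simp: path_blowup_def)
  moreover have "card ?F = ?D ^ (l div 2 + 1)"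
    by (subst card_PiE) (auto simp: card_even_atMost)
  ultimately show ?thesis by simp
qed

lemma ex_rainbow_path_lower:
  assumes "3 \<le> k"
  shows "(n div Suc l) ^ (l div 2 + 1) \<le> ex_rainbow n (path_graph l) (cycle_graph (2 * k))"
proof -
  have "card (copies (path_graph l) (path_blowup l n)) \<le> ex_rainbow n (path_graph l) (cycle_graph (2 * k))"
    using assms
    by (intro ex_rainbow_path_ge_if_no_copies simple_path_blowup no_long_cycle_in_path_blowup)
      (auto simp: path_blowup_def)
  thus ?thesis using card_path_copies_path_blowup[of n l] by linarith
qed

section \<open>Finite fields of characteristic two\<close>

lemma CHAR_bit: "CHAR(bit) = 2"
proof (rule CHAR_eqI)
  fix x assume "of_nat x = (0 :: bit)"
  thus "2 dvd x" by (cases "even x") (auto elim!: oddE)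
qed simp

lemma bit_closure_two: "(2 :: bit alg_closure) = 0"
  using of_nat_CHAR[where 'a = "bit alg_closure"] by (simp add: CHAR_bit)

text \<open>The polynomial \<open>x ^ q - x\<close> splits over the closure, and its derivative is
  \<open>-1\<close>, so its \<open>q\<close> roots are distinct.\<close>

lemma card_frobenius_fixed_points:
  fixes q :: nat
  assumes q: "q = 2 ^ j" "j > 0"
  shows "card {x :: bit alg_closure. x ^ q = x} = q"
proof -
  define p :: "bit alg_closure poly" where "p = monom 1 q - monom 1 1"
  have q1: "q > 1" using q one_less_power[of "2::nat" j] by auto
  have q0: "(of_nat q :: bit alg_closure) = 0" using q bit_closure_two by simp
  have p0: "p \<noteq> 0" using q1 by (auto simp: p_def poly_eq_iff)
  have deg: "degree p = q"
  proof -
    have "degree p = degree (monom (1 :: bit alg_closure) q + - monom 1 1)"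
      by (simp add: p_def)
    also have "\<dots> = q"
      using q1 by (subst degree_add_eq_left) (auto simp: degree_monom_eq)
    finally show ?thesis .
  qed
  have pd: "pderiv p = -1"
    using q0 by (simp add: p_def pderiv_diff pderiv_monom monom_0 flip: one_pCons)
  from alg_closed_imp_factorization[OF p0] obtain A
    where A: "size A = degree p" "p = smult (lead_coeff p) (\<Prod>x\<in>#A. [:-x, 1:])" by blast
  have roots: "set_mset A = {x. x ^ q = x}"
  proof -
    have "poly p x = 0 \<longleftrightarrow> x \<in># A" for x
      using p0 by (subst A(2)) (auto simp: poly_prod_mset prod_mset_zero_iff)
    moreover have "poly p x = x ^ q - x" for x by (simp add: p_def poly_monom)
    ultimately show ?thesis by auto
  qed
  have cnt: "count A x = 1" if "x \<in># A" for x
  proof (rule ccontr)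
    assume "count A x \<noteq> 1"
    from that obtain B where B: "A = add_mset x B" by (meson multi_member_split)
    with \<open>count A x \<noteq> 1\<close> have "x \<in># B" by (auto simp: not_in_iff)
    then obtain B' where "B = add_mset x B'" by (meson multi_member_split)
    \<comment> \<open>A repeated root gives a square factor, and by the product rule the derivative
      vanishes there.\<close>
    with A(2) B have "p = [:-x, 1:] * ([:-x, 1:] * smult (lead_coeff p) (\<Prod>x\<in>#B'. [:-x, 1:]))"
      by (simp add: algebra_simps)
    then obtain r where r: "p = [:-x, 1:] * ([:-x, 1:] * r)" by blast
    have "poly (pderiv p) x = 0" unfolding r pderiv_mult poly_add poly_mult by simp
    thus False by (simp add: pd)
  qed
  have "size A = card (set_mset A)"
    using cnt by (simp add: size_multiset_overloaded_eq)
  thus ?thesis using A(1) deg roots by simp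
qed

text \<open>The fixed points of the \<open>j\<close>-th iterate of the Frobenius map: sums are
  covered by the freshman's dream, and differences are sums in characteristic two.\<close>

lemma finite_subfield_exists:
  fixes j :: nat
  assumes "j > 0"
  shows "\<exists>F :: bit alg_closure set. card F = 2 ^ j \<and>
    (\<forall>x\<in>F. \<forall>y\<in>F. x * y \<in> F \<and> x + y \<in> F \<and> x - y \<in> F)"
proof -
  let ?q = "2 ^ j :: nat"
  let ?F = "{x :: bit alg_closure. x ^ ?q = x}"
  have add: "(x + y) ^ ?q = x ^ ?q + y ^ ?q" for x y :: "bit alg_closure"
    by (rule freshmans_dream'[of _ j]) (simp_all add: CHAR_bit)
  have neg: "- y = y" for y :: "bit alg_closure"
    using bit_closure_two by (metis add_eq_0_iff mult_2 mult_zero_left)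
  have "x - y = x + y" for x y :: "bit alg_closure"
    by (subst (2) neg[symmetric]) simp
  hence sub: "(x - y) ^ ?q = x ^ ?q - y ^ ?q" for x y :: "bit alg_closure"
    by (simp only: add)
  have "\<forall>x\<in>?F. \<forall>y\<in>?F. x * y \<in> ?F \<and> x + y \<in> ?F \<and> x - y \<in> ?F"
    by (simp add: power_mult_distrib add sub)
  thus ?thesis using card_frobenius_fixed_points[OF refl assms] by blast
qed

section \<open>Counting paths in graphs of large minimum degree\<close>

definition graph_paths :: "'a graph \<Rightarrow> 'a set \<Rightarrow> nat \<Rightarrow> 'a list set" where
  "graph_paths G U m = {vs. length vs = Suc m \<and> set vs \<subseteq> U \<and> distinct vs \<and>
     successively (\<lambda>u v. {u, v} \<in> edges G) vs}"

lemma finite_graph_paths: "finite U \<Longrightarrow> finite (graph_paths G U m)"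
  by (rule finite_subset[OF _ finite_lists_length_eq[of U "Suc m"]]) (auto simp: graph_paths_def)

text \<open>A path still to be extended has at most \<open>l\<close> vertices, which leaves
  \<open>d\<close> of the \<open>d + l\<close> neighbours of its head.\<close>

lemma card_graph_paths_ge:
  assumes U: "finite U" and deg: "\<And>u. u \<in> U \<Longrightarrow> d + l \<le> card {v\<in>U. {u, v} \<in> edges G}"
    and "m \<le> l"
  shows "d ^ m * card U \<le> card (graph_paths G U m)"
  using \<open>m \<le> l\<close>
proof (induction m)
  case 0
  have "card U \<le> card (graph_paths G U 0)"
    using U by (intro card_inj_on_le[where f = "\<lambda>u. [u]"])
      (auto simp: inj_on_def graph_paths_def finite_graph_paths[unfolded graph_paths_def])
  thus ?case by simp
next
  case (Suc m)
  have "d * card (graph_paths G U m) \<le> 1 * card (graph_paths G U (Suc m))"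
  proof (rule card_mult_le_fibrewise[where f = id and g = tl])
    fix vs assume "vs \<in> id ` graph_paths G U m"
    hence vs: "vs \<in> graph_paths G U m" by simp
    hence ne: "vs \<noteq> []" by (auto simp: graph_paths_def)
    hence hd: "hd vs \<in> U" using vs hd_in_set[of vs] by (auto simp: graph_paths_def)
    let ?A = "{v\<in>U. {hd vs, v} \<in> edges G} - set vs"
    have "card {v\<in>U. {hd vs, v} \<in> edges G} - card (set vs) \<le> card ?A"
      by (rule diff_card_le_card_Diff) simp
    moreover have "card (set vs) \<le> l"
      using vs Suc.prems by (auto simp: graph_paths_def intro: order_trans[OF card_length])
    ultimately have "d \<le> card ?A" using deg[OF hd] by linarith
    also have "\<dots> \<le> card {t \<in> graph_paths G U (Suc m). tl t = vs}"
    proof (rule card_inj_on_le[where f = "\<lambda>v. v # vs"])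
      show "(\<lambda>v. v # vs) ` ?A \<subseteq> {t \<in> graph_paths G U (Suc m). tl t = vs}"
        using vs ne by (auto simp: graph_paths_def successively_Cons insert_commute)
    qed (auto simp: inj_on_def finite_graph_paths[OF U])
    finally have "d \<le> card {t \<in> graph_paths G U (Suc m). tl t = vs}" .
    moreover have "{s \<in> graph_paths G U m. id s = vs} = {vs}" using vs by auto
    ultimately show "d * card {s \<in> graph_paths G U m. id s = vs}
        \<le> 1 * card {t \<in> graph_paths G U (Suc m). tl t = vs}" by simp
  qed (simp_all add: finite_graph_paths[OF U])
  moreover have "d * (d ^ m * card U) \<le> d * card (graph_paths G U m)"
    using Suc by (intro mult_left_mono) auto
  ultimately show ?case
    by (simp only: power_Suc mult.assoc mult_1)
qed

text \<open>A list tracing a copy uses only its vertices, at most \<open>l + 1\<close> of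
  them.\<close>

lemma card_graph_paths_le:
  assumes "finite (verts G)" "U \<subseteq> verts G"
  shows "card (graph_paths G U l) \<le> Suc l ^ Suc l * card (copies (path_graph l) G)"
proof (rule card_le_fibres[where f = walk_graph])
  have U: "finite U" using assms finite_subset by blast
  show "finite (graph_paths G U l)" by (rule finite_graph_paths[OF U])
  show "finite (copies (path_graph l) G)" by (rule finite_path_copies(1)[OF assms(1)])
  show "walk_graph ` graph_paths G U l \<subseteq> copies (path_graph l) G"
  proof (rule image_subsetI)
    fix vs assume vs: "vs \<in> graph_paths G U l"
    hence len: "length vs = Suc l" by (simp add: graph_paths_def)
    have set: "(!) vs ` {..<Suc l} = set vs"
      unfolding len[symmetric] by (auto simp: set_conv_nth)
    show "walk_graph vs \<in> copies (path_graph l) G"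
      unfolding in_copies_iff[OF simple_path_graph] path_graph_image
    proof (intro exI[of _ "(!) vs"] conjI ballI)
      show "inj_on ((!) vs) {..<Suc l}"
        using vs by (auto simp: inj_on_def graph_paths_def nth_eq_iff_index_eq)
      show "walk_graph vs = ((!) vs ` {..<Suc l}, (`) ((!) vs) ` (\<lambda>i. {i, Suc i}) ` {..<l})"
        unfolding set by (simp add: walk_graph_def len image_image)
      show "(!) vs ` {..<Suc l} \<subseteq> verts G"
        unfolding set using vs assms(2) by (auto simp: graph_paths_def)
      fix e assume "e \<in> (\<lambda>i. {i, Suc i}) ` {..<l}"
      thus "(!) vs ` e \<in> edges G"
        using vs by (auto simp: graph_paths_def successively_conv_nth)
    qed
  qed
  fix S assume "S \<in> copies (path_graph l) G"
  then obtain g where g: "verts S = g ` {..<Suc l}"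
    by (auto simp: in_copies_iff[OF simple_path_graph] path_graph_image)
  let ?L = "{vs. set vs \<subseteq> verts S \<and> length vs = Suc l}"
  have fin: "finite (verts S)" by (simp add: g)
  have "card {s \<in> graph_paths G U l. walk_graph s = S} \<le> card ?L"
    by (intro card_mono finite_lists_length_eq fin) (auto simp: graph_paths_def walk_graph_def)
  also have "\<dots> = card (verts S) ^ Suc l" by (rule card_lists_length_eq[OF fin])
  also have "\<dots> \<le> Suc l ^ Suc l"
    using card_image_le[of "{..<Suc l}" g] by (intro power_mono) (auto simp: g)
  finally show "card {s \<in> graph_paths G U l. walk_graph s = S} \<le> Suc l ^ Suc l" .
qed

text \<open>The incidence graph of the points \<open>(x, y)\<close> and the lines \<open>y = m x + b\<close> of an affine plane.\<close>

lemma incidence_graph_exists: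
  fixes j n :: nat
  defines "q \<equiv> 2 ^ j :: nat"
  assumes j: "j > 0" and n: "2 * q ^ 2 \<le> n"
  shows "\<exists>(G :: nat graph) U. simple_graph G \<and> card (verts G) = n \<and> U \<subseteq> verts G \<and> card U = 2 * q ^ 2 \<and>
    (\<forall>u\<in>U. q \<le> card {v\<in>U. {u, v} \<in> edges G}) \<and> copies (cycle_graph 4) G = {}"
proof -
  obtain F :: "bit alg_closure set" where F: "card F = q"
    and closed: "\<And>x y. x \<in> F \<Longrightarrow> y \<in> F \<Longrightarrow> x * y \<in> F" "\<And>x y. x \<in> F \<Longrightarrow> y \<in> F \<Longrightarrow> x + y \<in> F"
      "\<And>x y. x \<in> F \<Longrightarrow> y \<in> F \<Longrightarrow> x - y \<in> F"
    using finite_subfield_exists[OF j] unfolding q_def by blast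
  have finF: "finite F" using F by (intro card_ge_0_finite) (simp add: q_def)
  let ?T = "(F \<times> F) <+> (F \<times> F)"
  have cT: "card ?T = 2 * q ^ 2"
    using finF F by (simp add: card_Plus card_cartesian_product power2_eq_square)
  have finT: "finite ?T" using finF by simp
  \<comment> \<open>Points and lines become numbers below \<open>n\<close>; the remaining vertices
    are isolated, and \<open>U\<close> will be the image of \<phi>.\<close>
  obtain \<phi> where \<phi>: "\<phi> ` ?T \<subseteq> {..<n}" "inj_on \<phi> ?T"
    using card_le_inj[OF finT, of "{..<n}"] cT n by auto
  define E where "E u v \<longleftrightarrow> (\<exists>x\<in>F. \<exists>y\<in>F. \<exists>m\<in>F. \<exists>b\<in>F. y = m * x + b \<and> u = \<phi> (Inl (x, y)) \<and> v = \<phi> (Inr (m, b)))" for u v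
  have E_I: "E (\<phi> (Inl (x, y))) (\<phi> (Inr (m, b)))"
    if "x \<in> F" "y \<in> F" "m \<in> F" "b \<in> F" "y = m * x + b" for x y m b
    using that unfolding E_def by blast
  define G where "G = ({..<n}, {{u, v} | u v. E u v})"
  have lt: "u < n" "v < n" if "E u v" for u v
    using that \<phi>(1) unfolding E_def by blast+
  have asym: "\<not> E v w" if uv: "E u v" for u v w
  proof
    assume "E v w"
    then obtain x y where xy: "x \<in> F" "y \<in> F" "v = \<phi> (Inl (x, y))" unfolding E_def by blast
    obtain m b where mb: "m \<in> F" "b \<in> F" "v = \<phi> (Inr (m, b))" using uv unfolding E_def by blast
    have "Inl (x, y) = (Inr (m, b) :: _ + bit alg_closure \<times> bit alg_closure)"
      by (rule inj_onD[OF \<phi>(2)]) (use xy mb in auto)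
    thus False by simp
  qed
  have edge: "{u, v} \<in> edges G \<longleftrightarrow> E u v \<or> E v u" for u v
    by (auto simp: G_def doubleton_eq_iff)
  \<comment> \<open>Two different lines share at most one point: subtracting the equations gives
    \<open>(m - m') * (x - x') = 0\<close> in a field.\<close>
  have rect: "u = u' \<or> v = v'" if E4: "E u v" "E u v'" "E u' v" "E u' v'" for u u' v v'
  proof -
    have pt: "\<exists>x\<in>F. \<exists>y\<in>F. u = \<phi> (Inl (x, y))" if "E u v" for u v using that unfolding E_def by blast
    have ln: "\<exists>m\<in>F. \<exists>b\<in>F. v = \<phi> (Inr (m, b))" if "E u v" for u v using that unfolding E_def by blast
    have incident: "y = m * x + b" if inc: "E (\<phi> (Inl (x, y))) (\<phi> (Inr (m, b)))" "x \<in> F" "y \<in> F" "m \<in> F" "b \<in> F" for x y m b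
    proof -
      obtain x' y' m' b' where *: "x' \<in> F" "y' \<in> F" "m' \<in> F" "b' \<in> F" "y' = m' * x' + b'"
        "\<phi> (Inl (x, y)) = \<phi> (Inl (x', y'))" "\<phi> (Inr (m, b)) = \<phi> (Inr (m', b'))"
        using inc(1) unfolding E_def by blast
      have "Inl (x, y) = (Inl (x', y') :: _ + bit alg_closure \<times> bit alg_closure)"
        by (rule inj_onD[OF \<phi>(2)]) (use * inc in auto)
      moreover have "Inr (m, b) = (Inr (m', b') :: bit alg_closure \<times> bit alg_closure + _)"
        by (rule inj_onD[OF \<phi>(2)]) (use * inc in auto)
      ultimately show ?thesis using * by simp
    qed
    obtain x y where u: "x \<in> F" "y \<in> F" "u = \<phi> (Inl (x, y))" using pt[OF E4(1)] by blast
    obtain x' y' where u': "x' \<in> F" "y' \<in> F" "u' = \<phi> (Inl (x', y'))" using pt[OF E4(3)] by blast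
    obtain m b where v: "m \<in> F" "b \<in> F" "v = \<phi> (Inr (m, b))" using ln[OF E4(1)] by blast
    obtain m' b' where v': "m' \<in> F" "b' \<in> F" "v' = \<phi> (Inr (m', b'))" using ln[OF E4(2)] by blast
    have eqs: "y = m * x + b" "y = m' * x + b'" "y' = m * x' + b" "y' = m' * x' + b'"
      using E4 incident u u' v v' by simp_all
    have "m * x + b - (m * x' + b) = m' * x + b' - (m' * x' + b')"
      using eqs by metis
    hence "(m - m') * (x - x') = 0" by (simp add: algebra_simps)
    hence "m = m' \<or> x = x'" by simp
    thus ?thesis
    proof
      assume "m = m'"
      with eqs have "b = b'" by (metis add_left_cancel)
      thus ?thesis using \<open>m = m'\<close> v v' by simp
    next
      assume "x = x'"
      with eqs have "y = y'" by simp
      thus ?thesis using \<open>x = x'\<close> u u' by simp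
    qed
  qed
  have simple: "simple_graph G"
    using lt asym by (fastforce simp: simple_graph_def G_def card_insert_if)
  \<comment> \<open>A point lies on one line of each slope, and a line has one point for each
    abscissa.\<close>
  have deg: "q \<le> card {v \<in> \<phi> ` ?T. {u, v} \<in> edges G}" if u: "u \<in> \<phi> ` ?T" for u
  proof -
    have fin: "finite {v \<in> \<phi> ` ?T. {u, v} \<in> edges G}" using finT by simp
    from u consider x y where "x \<in> F" "y \<in> F" "u = \<phi> (Inl (x, y))"
      | m b where "m \<in> F" "b \<in> F" "u = \<phi> (Inr (m, b))" by auto
    thus ?thesis
    proof cases
      case (1 x y)
      let ?h = "\<lambda>m. \<phi> (Inr (m, y - m * x))"
      have E: "E u (?h m)" "Inr (m, y - m * x) \<in> ?T" if "m \<in> F" for m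
        using 1 that closed by (auto intro!: E_I)
      have "card F \<le> card {v \<in> \<phi> ` ?T. {u, v} \<in> edges G}"
      proof (rule card_inj_on_le[OF _ _ fin])
        show "inj_on ?h F"
          using E(2) inj_onD[OF \<phi>(2)] by (intro inj_onI) blast
        show "?h ` F \<subseteq> {v \<in> \<phi> ` ?T. {u, v} \<in> edges G}"
          using E unfolding edge by blast
      qed
      thus ?thesis by (simp add: F)
    next
      case (2 m b)
      let ?h = "\<lambda>x. \<phi> (Inl (x, m * x + b))"
      have E: "E (?h x) u" "Inl (x, m * x + b) \<in> ?T" if "x \<in> F" for x
        using 2 that closed by (auto intro!: E_I)
      have "card F \<le> card {v \<in> \<phi> ` ?T. {u, v} \<in> edges G}"
      proof (rule card_inj_on_le[OF _ _ fin])
        show "inj_on ?h F"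
          using E(2) inj_onD[OF \<phi>(2)] by (intro inj_onI) blast
        show "?h ` F \<subseteq> {v \<in> \<phi> ` ?T. {u, v} \<in> edges G}"
          using E unfolding edge by blast
      qed
      thus ?thesis by (simp add: F)
    qed
  qed
  have no4: "copies (cycle_graph 4) G = {}"
  proof (rule equals0I)
    fix S assume "S \<in> copies (cycle_graph 4) G"
    then obtain g where inj: "inj_on g {..<4::nat}"
      and e: "\<And>i. i < 4 \<Longrightarrow> {g i, g (Suc i mod 4)} \<in> edges G"
      by (auto simp: in_copies_iff[OF simple_cycle_graph] cycle_graph_image)
    have ne: "g 0 \<noteq> g 2" "g 1 \<noteq> g 3"
      using inj by (auto dest: inj_onD)
    have "E (g 0) (g 1) \<or> E (g 1) (g 0)" "E (g 1) (g 2) \<or> E (g 2) (g 1)"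
      "E (g 2) (g 3) \<or> E (g 3) (g 2)" "E (g 3) (g 0) \<or> E (g 0) (g 3)"
      using e[of 0] e[of 1] e[of 2] e[of 3] by (simp_all add: edge flip: numeral_2_eq_2)
    \<comment> \<open>By \<open>asym\<close> the points of the cycle sit either at the even or at
      the odd positions, hence the two instances of \<open>rect\<close>.\<close>
    thus False
      using asym rect[of "g 0" "g 1" "g 3" "g 2"] rect[of "g 1" "g 0" "g 2" "g 3"] ne by blast
  qed
  have "card (\<phi> ` ?T) = 2 * q ^ 2" using cT card_image[OF \<phi>(2)] by simp
  moreover have "card (verts G) = n" "\<phi> ` ?T \<subseteq> verts G" using \<phi>(1) by (auto simp: G_def)
  ultimately show ?thesis using simple deg no4 by blast
qed

text \<open>The largest \<open>q = 2 ^ j\<close> with \<open>2 * q ^ 2 \<le> n\<close> satisfies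
  \<open>n < 8 * q ^ 2\<close>. Then \<open>n \<ge> 32 * l ^ 2\<close> gives
  \<open>2 * l < q\<close>, so degrees reduced by \<open>l\<close> are still at least
  \<open>q / 2\<close>, and the paths number at least a constant times
  \<open>q ^ (l + 2)\<close>.\<close>

lemma ex_rainbow_path_lower_powr:
  assumes n: "n \<ge> 8" "n \<ge> 32 * l ^ 2"
  shows "(1 / (2 ^ l * real (Suc l ^ Suc l)) * (1 / 8) powr (real l / 2 + 1)) * real n powr (real l / 2 + 1)
    \<le> real (ex_rainbow n (path_graph l) (cycle_graph 4))"
proof -
  have "1 \<le> n div 2" using n by simp
  then obtain j where j: "4 ^ j \<le> n div 2" "n div 2 < 4 ^ (j + 1)"
    using ex_power_ivl1[of 4 "n div 2"] by auto
  define q where "q = (2 ^ j :: nat)"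
  have q2: "q ^ 2 = 4 ^ j"
    using power_mult[of "2 :: nat" 2 j] power_mult[of "2 :: nat" j 2] by (simp add: q_def mult.commute)
  have n1: "2 * q ^ 2 \<le> n" and n2: "n < 8 * q ^ 2" using j by (auto simp: q2)
  have "j > 0" using n2 n(1) by (cases j) (auto simp: q_def)
  then obtain G :: "nat graph" and U where G: "simple_graph G" "card (verts G) = n" "U \<subseteq> verts G"
    "card U = 2 * q ^ 2" "\<forall>u\<in>U. q \<le> card {v\<in>U. {u, v} \<in> edges G}" "copies (cycle_graph 4) G = {}"
    using incidence_graph_exists[of j n] n1 unfolding q_def by blast
  have fin: "finite (verts G)" using G(1) by (simp add: simple_graph_def)
  have "(2 * l) ^ 2 < q ^ 2" using n2 n(2) by (simp add: power2_eq_square)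
  hence ql: "2 * l < q" by (rule power_less_imp_less_base) simp
  \<comment> \<open>The minimum degree \<open>q\<close> is read as
    \<open>(q - l) + l\<close>.\<close>
  have "(q - l) ^ l * card U \<le> card (graph_paths G U l)"
    using G(5) ql finite_subset[OF G(3) fin] by (intro card_graph_paths_ge[where l = l]) auto
  also have "\<dots> \<le> Suc l ^ Suc l * card (copies (path_graph l) G)"
    by (rule card_graph_paths_le[OF fin G(3)])
  also have "\<dots> \<le> Suc l ^ Suc l * ex_rainbow n (path_graph l) (cycle_graph 4)"
    using G by (intro mult_left_mono ex_rainbow_path_ge_if_no_copies) auto
  finally have main: "real ((q - l) ^ l * card U) \<le> real (Suc l ^ Suc l * ex_rainbow n (path_graph l) (cycle_graph 4))"
    by (simp only: of_nat_le_iff)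
  have q0: "real q > 0" by (simp add: q_def)
  have "(1 / 8) powr (real l / 2 + 1) * real n powr (real l / 2 + 1) = (real n / 8) powr (real l / 2 + 1)"
    by (subst powr_mult[symmetric]) auto
  also have "\<dots> \<le> (real q ^ 2) powr (real l / 2 + 1)"
  proof (rule powr_mono2)
    have "real n < real (8 * q ^ 2)" using n2 by (simp only: of_nat_less_iff)
    thus "real n / 8 \<le> real q ^ 2" by simp
  qed auto
  also have "\<dots> = real q ^ (l + 2)"
  proof -
    have "(real q ^ 2) powr (real l / 2 + 1) = real q powr (2 * (real l / 2 + 1))"
      using q0 by (simp only: powr_realpow[symmetric] powr_powr) simp
    also have "2 * (real l / 2 + 1) = real (l + 2)" by simp
    finally show ?thesis using q0 by (simp only: powr_realpow)
  qed
  also have "\<dots> = 2 ^ l * ((real q / 2) ^ l * real q ^ 2)"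
    by (simp add: power_divide power_add power2_eq_square)
  also have "\<dots> \<le> 2 ^ l * (real (q - l) ^ l * real q ^ 2)"
    using ql by (intro mult_left_mono mult_right_mono power_mono) auto
  also have "\<dots> \<le> 2 ^ l * real ((q - l) ^ l * card U)"
    by (simp add: G(4))
  also have "\<dots> \<le> 2 ^ l * real (Suc l ^ Suc l * ex_rainbow n (path_graph l) (cycle_graph 4))"
    by (intro mult_left_mono main) simp
  finally have "(1 / 8) powr (real l / 2 + 1) * real n powr (real l / 2 + 1)
      \<le> 2 ^ l * real (Suc l ^ Suc l) * real (ex_rainbow n (path_graph l) (cycle_graph 4))"
    by (simp only: of_nat_mult mult.assoc)
  moreover have "0 < real (Suc l ^ Suc l)" by (simp only: of_nat_0_less_iff zero_less_power zero_less_Suc)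
  ultimately show ?thesis by (simp add: divide_le_eq pos_divide_le_eq mult_ac)
qed

section \<open>Assembling the asymptotics\<close>

lemma nat_ceiling_half: "nat \<lceil>(real l + 1) / 2\<rceil> = l div 2 + 1"
proof (cases "even l")
  case True
  then obtain j where "l = 2 * j" by blast
  moreover have "\<lceil>(real (2 * j) + 1) / 2\<rceil> = int j + 1" by (rule ceiling_unique) auto
  ultimately show ?thesis by simp
next
  case False
  then obtain j where "l = 2 * j + 1" by (auto elim: oddE)
  moreover have "\<lceil>(real (2 * j + 1) + 1) / 2\<rceil> = int j + 1" by (rule ceiling_unique) auto
  ultimately show ?thesis by simp
qed

theorem theorem1p4:
  fixes k l :: nat
  assumes "k \<ge> 2" and "l \<ge> 2"
  shows "(k \<ge> 3 \<longrightarrow>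
      (\<lambda>n. real (ex_rainbow n (path_graph l) (cycle_graph (2 * k))))
        \<in> \<Theta>(\<lambda>n. real n ^ nat \<lceil>(real l + 1) / 2\<rceil>)) \<and>
    (k = 2 \<longrightarrow>
      (\<lambda>n. real (ex_rainbow n (path_graph l) (cycle_graph (2 * k))))
        \<in> \<Theta>(\<lambda>n. real n powr (real l / 2 + 1)))"
proof (intro conjI impI)
  let ?f = "\<lambda>n. real (ex_rainbow n (path_graph l) (cycle_graph (2 * k)))"
  assume k: "k \<ge> 3"
  let ?e = "l div 2 + 1"
  have "?f \<in> O(\<lambda>n. real n ^ ?e)"
    using ex_rainbow_path_upper[OF k assms(2)]
    by (intro bigoI[of _ "real (20000 * k ^ 3 * (12 * k) ^ l)"] always_eventually allI) simp
  moreover have "?f \<in> \<Omega>(\<lambda>n. real n ^ ?e)"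
  proof (rule landau_omega.bigI)
    show "0 < (1 / (2 * real (Suc l))) ^ ?e" by simp
    show "\<forall>\<^sub>F n in sequentially. (1 / (2 * real (Suc l))) ^ ?e * norm (real n ^ ?e) \<le> norm (?f n)"
    \<comment> \<open>From \<open>n = l + 1\<close> on the quotient is at least 1, so rounding down
      costs at most a factor of two.\<close>
    proof (rule eventually_sequentiallyI[of "Suc l"])
      fix n assume n: "Suc l \<le> n"
      let ?d = "n div Suc l"
      have "0 < ?d" using n by (simp add: div_greater_zero_iff)
      hence "Suc l \<le> Suc l * ?d"
        using mult_le_mono2[of 1 ?d "Suc l"] by (simp del: mult_Suc)
      moreover have "n < Suc l * ?d + Suc l"
        using dividend_less_div_times[OF zero_less_Suc, of n l] by (simp only: mult.commute add.commute)
      ultimately have "n \<le> 2 * Suc l * ?d" by (simp only: mult.assoc)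
      hence "real n \<le> real (2 * Suc l * ?d)" by (simp only: of_nat_le_iff)
      hence "1 / (2 * real (Suc l)) * real n \<le> real ?d" by (simp add: field_simps)
      hence "(1 / (2 * real (Suc l)) * real n) ^ ?e \<le> real ?d ^ ?e" by (intro power_mono) auto
      also have "\<dots> \<le> ?f n"
        using ex_rainbow_path_lower[OF k, of n l] by (simp only: of_nat_power[symmetric] of_nat_le_iff)
      finally show "(1 / (2 * real (Suc l))) ^ ?e * norm (real n ^ ?e) \<le> norm (?f n)"
        by (simp only: power_mult_distrib) simp
    qed
  qed
  ultimately show "?f \<in> \<Theta>(\<lambda>n. real n ^ nat \<lceil>(real l + 1) / 2\<rceil>)"
    unfolding nat_ceiling_half by (rule bigthetaI)
next
  let ?f = "\<lambda>n. real (ex_rainbow n (path_graph l) (cycle_graph (2 * k)))"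
  let ?g = "\<lambda>n. real n powr (real l / 2 + 1)"
  let ?c = "1 / (2 ^ l * real (Suc l ^ Suc l)) * (1 / 8) powr (real l / 2 + 1)"
  assume k: "k = 2"
  have "?f \<in> O(?g)"
    using ex_rainbow_path_upper_powr[OF assms(1), of _ l]
    by (intro bigoI[of _ "(12 * real k) ^ (l + 1)"] always_eventually allI) simp
  moreover have "?f \<in> \<Omega>(?g)"
  proof (rule landau_omega.bigI)
    have "0 < real (Suc l ^ Suc l)" by (simp only: of_nat_0_less_iff zero_less_power zero_less_Suc)
    thus "0 < ?c" by (intro mult_pos_pos divide_pos_pos) auto
    show "\<forall>\<^sub>F n in sequentially. ?c * norm (?g n) \<le> norm (?f n)"
    proof (rule eventually_sequentiallyI[of "max 8 (32 * l ^ 2)"])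
      fix n assume "max 8 (32 * l ^ 2) \<le> n"
      hence "?c * ?g n \<le> real (ex_rainbow n (path_graph l) (cycle_graph 4))"
        by (intro ex_rainbow_path_lower_powr) auto
      thus "?c * norm (?g n) \<le> norm (?f n)" by (simp add: k)
    qed
  qed
  ultimately show "?f \<in> \<Theta>(?g)" by (rule bigthetaI)
qed

end
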